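(* Let $G$ and $G'$ be simple matroids such that $\mathcal{A}(G)\cong\mathcal{A}(G')$ as graded algebras, and let $\bar G$ and $\bar{G'}$ denote the corank-one truncations of $G$ and $G'$ respectively. Then $\mathcal{A}(\bar G)\cong\mathcal{A}(\bar{G'})$ as graded algebras.
   Context: For a simple matroid $H$ on a finite ground set $E$, let $\mathcal{E}=\Lambda(e_i : i\in E)$ be the graded exterior algebra over $\mathbb{C}$ with generators $e_i$ of degree one. For an ordered tuple $S=(i_1,\ldots,i_p)$ write $e_S=e_{i_1}\wedge\cdots\wedge e_{i_p}$ and define $\partial:\mathcal{E}^p\to\mathcal{E}^{p-1}$ by $\partial(e_{i_1}\wedge\cdots\wedge e_{i_p})=\sum_{k=1}^p(-1)^{k-1}e_{i_1}\wedge\cdots\wedge\widehat{e_{i_k}}\wedge\cdots\wedge e_{i_p}$. Let $\mathcal{I}$ be the ideal generated by $\{\partial e_S : S\text{ dependent in }H\}$; the Orlik-Solomon algebra of $H$ is the graded algebra $\mathcal{A}(H)=\mathcal{E}/\mathcal{I}$. The corank-one truncation $\bar H$ of a matroid $H$ of rank $r$ is the matroid on the same ground set whose independent sets are the independent sets of $H$ of cardinality at most $r-1$. *)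

theory Defs
  imports Complex_Main "HOL-Library.Poly_Mapping" "HOL-Algebra.QuotRing" "HOL-Algebra.Module"
begin

section \<open>Simple matroids and truncation\<close>

locale matroid =
  fixes E :: "'a set" and indep :: "'a set \<Rightarrow> bool"
  assumes finite_ground: "finite E"
    and indep_subset_ground: "indep X \<Longrightarrow> X \<subseteq> E"
    and indep_empty: "indep {}"
    and indep_subset: "indep X \<Longrightarrow> Y \<subseteq> X \<Longrightarrow> indep Y"
    and augmentation: "indep X \<Longrightarrow> indep Y \<Longrightarrow> card X < card Y \<Longrightarrow>
      \<exists>y \<in> Y - X. indep (insert y X)"

locale simple_matroid = matroid E indep
  for E :: "'a set" and indep :: "'a set \<Rightarrow> bool" +
  assumes no_loops: "x \<in> E \<Longrightarrow> indep {x}"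
    and no_parallel: "x \<in> E \<Longrightarrow> y \<in> E \<Longrightarrow> indep {x, y}"

definition matroid_rank :: "('a set \<Rightarrow> bool) \<Rightarrow> nat" where
  "matroid_rank indep = Max (card ` {X. indep X})"

text \<open>
  The strict inequality says that the cardinality is at most the rank minus one, without the
  truncated subtraction of natural numbers. In rank zero the truncation has no independent set
  at all; the Orlik--Solomon algebra of a rank-zero simple matroid (whose ground set is empty)
  does not change, since the boundary of the empty product is zero.
\<close>

definition truncation :: "('a set \<Rightarrow> bool) \<Rightarrow> 'a set \<Rightarrow> bool" where
  "truncation indep X \<longleftrightarrow> indep X \<and> card X < matroid_rank indep"

section \<open>Graded algebras\<close>

text \<open>
  A graded algebra is given by the scalar multiplication of the record type of modules together
  with its homogeneous parts.
\<close>

record ('k, 'b) graded_algebra = "('k, 'b) module" +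
  homog :: "nat \<Rightarrow> 'b set"

definition graded_Quot :: "('k, 'b) graded_algebra \<Rightarrow> 'b set \<Rightarrow> ('k, 'b set) graded_algebra" where
  "graded_Quot A I =
    \<lparr>carrier = carrier (A Quot I), mult = mult (A Quot I), one = one (A Quot I),
     zero = zero (A Quot I), add = add (A Quot I),
     smult = (\<lambda>c X. \<Union>x\<in>X. I +>\<^bsub>A\<^esub> (c \<odot>\<^bsub>A\<^esub> x)),
     homog = (\<lambda>n. (\<lambda>x. I +>\<^bsub>A\<^esub> x) ` homog A n)\<rparr>"

definition graded_algebra_iso ::
    "('k, 'b) graded_algebra \<Rightarrow> ('k, 'c) graded_algebra \<Rightarrow> ('b \<Rightarrow> 'c) set" where
  "graded_algebra_iso A B =
    {h \<in> ring_iso A B.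
      (\<forall>c. \<forall>x \<in> carrier A. h (c \<odot>\<^bsub>A\<^esub> x) = c \<odot>\<^bsub>B\<^esub> h x) \<and>
      (\<forall>n. h ` homog A n = homog B n)}"

definition graded_algebra_isomorphic ::
    "('k, 'b) graded_algebra \<Rightarrow> ('k, 'c) graded_algebra \<Rightarrow> bool" where
  "graded_algebra_isomorphic A B \<longleftrightarrow> graded_algebra_iso A B \<noteq> {}"

section \<open>The exterior algebra\<close>

text \<open>
  Words form the free monoid, written additively because \<^typ>\<open>'m \<Rightarrow>\<^sub>0 complex\<close> is the monoid
  algebra of an additive monoid. The tensor algebra of the complex vector space with basis \<open>E\<close>
  is thus the algebra of finitely supported functions on the words over \<open>E\<close>.
\<close>

datatype 'a word = Word (letters: "'a list")

instantiation word :: (type) monoid_add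
begin

definition zero_word :: "'a word" where
  "0 = Word []"

definition plus_word :: "'a word \<Rightarrow> 'a word \<Rightarrow> 'a word" where
  "u + v = Word (letters u @ letters v)"

instance
  by standard (simp_all add: zero_word_def plus_word_def)

end

definition tensor_algebra :: "'a set \<Rightarrow> (complex, 'a word \<Rightarrow>\<^sub>0 complex) graded_algebra" where
  "tensor_algebra E =
    \<lparr>carrier = {p. \<forall>w \<in> Poly_Mapping.keys p. set (letters w) \<subseteq> E},
     mult = (*), one = 1, zero = 0, add = (+),
     smult = (\<lambda>c p. Poly_Mapping.map ((*) c) p),
     homog = (\<lambda>n. {p. \<forall>w \<in> Poly_Mapping.keys p.
                        set (letters w) \<subseteq> E \<and> length (letters w) = n})\<rparr>"

definition exterior_ideal :: "'a set \<Rightarrow> ('a word \<Rightarrow>\<^sub>0 complex) set" where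
  "exterior_ideal E =
    genideal (tensor_algebra E)
      {v \<otimes>\<^bsub>tensor_algebra E\<^esub> v | v. v \<in> homog (tensor_algebra E) 1}"

definition exterior_algebra ::
    "'a set \<Rightarrow> (complex, ('a word \<Rightarrow>\<^sub>0 complex) set) graded_algebra" where
  "exterior_algebra E = graded_Quot (tensor_algebra E) (exterior_ideal E)"

definition ext_gen :: "'a set \<Rightarrow> 'a \<Rightarrow> ('a word \<Rightarrow>\<^sub>0 complex) set" where
  "ext_gen E i = exterior_ideal E +>\<^bsub>tensor_algebra E\<^esub> Poly_Mapping.single (Word [i]) 1"

definition ext_monom :: "'a set \<Rightarrow> 'a list \<Rightarrow> ('a word \<Rightarrow>\<^sub>0 complex) set" where
  "ext_monom E S =
    foldr (\<lambda>i x. ext_gen E i \<otimes>\<^bsub>exterior_algebra E\<^esub> x) S \<one>\<^bsub>exterior_algebra E\<^esub>"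

text \<open>
  The element \<open>\<partial> e\<^sub>S\<close> for a tuple \<open>S\<close>. Positions are counted from zero here, so that the sign is
  \<open>(-1) ^ k\<close>.
\<close>

definition ext_boundary :: "'a set \<Rightarrow> 'a list \<Rightarrow> ('a word \<Rightarrow>\<^sub>0 complex) set" where
  "ext_boundary E S =
    (\<Oplus>\<^bsub>exterior_algebra E\<^esub> k \<in> {..<length S}.
      ((-1) ^ k) \<odot>\<^bsub>exterior_algebra E\<^esub> ext_monom E (take k S @ drop (Suc k) S))"

section \<open>The Orlik--Solomon algebra\<close>

text \<open>
  Tuples with repeated entries are harmless: both \<open>e\<^sub>S\<close> and \<open>\<partial> e\<^sub>S\<close> vanish for them.
\<close>

definition os_ideal :: "'a set \<Rightarrow> ('a set \<Rightarrow> bool) \<Rightarrow> ('a word \<Rightarrow>\<^sub>0 complex) set set" where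
  "os_ideal E indep =
    genideal (exterior_algebra E)
      {ext_boundary E S | S. set S \<subseteq> E \<and> \<not> indep (set S)}"

definition os_algebra ::
    "'a set \<Rightarrow> ('a set \<Rightarrow> bool) \<Rightarrow> (complex, ('a word \<Rightarrow>\<^sub>0 complex) set set) graded_algebra" where
  "os_algebra E indep = graded_Quot (exterior_algebra E) (os_ideal E indep)"

end

theory Submission
  imports Defs
begin

text \<open>
  Both matroids are simple, so an isomorphism of their Orlik--Solomon algebras is induced by a linear
  isomorphism \<open>F\<close> of the degree-one parts that carries the ideal \<open>I\<close> onto \<open>I'\<close>. The ideal of the
  truncation is generated by \<open>I\<close> and the boundaries of all monomials of degree at least the rank
  \<open>r\<close>, and \<open>r\<close> is the largest degree in which the algebra does not vanish. So it suffices to make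
  \<open>F\<close> commute with the boundary \<open>\<partial>\<close>.

  The transported antiderivation \<open>\<delta> = F \<partial> F\<^sup>-\<^sup>1\<close> preserves \<open>I'\<close>, as does \<open>\<partial>\<close>. Choose a letter \<open>w\<close> with
  \<open>\<delta> w \<noteq> 0\<close>. The substitution \<open>e\<^sub>i \<mapsto> e\<^sub>i + (\<delta> e\<^sub>i - 1) w\<close> acts on the exterior algebra as
  \<open>1 + w (\<delta> - \<partial>)\<close>, hence preserves \<open>I'\<close>; it is invertible and conjugates \<open>\<delta>\<close> into \<open>\<partial>\<close>.

  All computations take place in the tensor algebra, modulo the preimage \<open>os_ker\<close> of the
  Orlik--Solomon ideal.
\<close>

section \<open>Words, scalars and induction over monomials\<close>

abbreviation wd :: "'a list \<Rightarrow> 'a word \<Rightarrow>\<^sub>0 complex" where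
  "wd u \<equiv> Poly_Mapping.single (Word u) 1"

text \<open>Scalars are the multiples of the empty word, so scalar multiplication becomes
  multiplication in the ring.\<close>

abbreviation cst :: "complex \<Rightarrow> 'a word \<Rightarrow>\<^sub>0 complex" where
  "cst c \<equiv> Poly_Mapping.single 0 c"

lemma wd_Nil [simp]: "wd [] = 1"
  by (simp flip: zero_word_def)

lemma wd_append: "wd (u @ v) = wd u * wd v"
  by (simp add: mult_single plus_word_def)

lemma wd_Cons: "wd (i # u) = wd [i] * wd u"
  using wd_append[of "[i]" u] by simp

lemma cst_mult: "cst (c * d) = cst c * cst d"
  by (simp add: mult_single)

lemma cst_eq_one_iff [simp]: "cst c = 1 \<longleftrightarrow> c = 1"
  by (metis lookup_single_eq single_one)

lemma single_eq_cst_wd: "Poly_Mapping.single w c = cst c * wd (letters w)"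
  by (simp add: mult_single)

lemma sum_singles: "p = (\<Sum>w\<in>Poly_Mapping.keys p. Poly_Mapping.single w (Poly_Mapping.lookup p w))"
proof (rule poly_mapping_eqI)
  fix k
  have "(\<Sum>w\<in>Poly_Mapping.keys p. Poly_Mapping.lookup (Poly_Mapping.single w (Poly_Mapping.lookup p w)) k)
      = (\<Sum>w\<in>Poly_Mapping.keys p. if w = k then Poly_Mapping.lookup p w else 0)"
    by (rule sum.cong) (auto simp: lookup_single when_def)
  then show "Poly_Mapping.lookup p k =
      Poly_Mapping.lookup (\<Sum>w\<in>Poly_Mapping.keys p. Poly_Mapping.single w (Poly_Mapping.lookup p w)) k"
    by (auto simp: lookup_sum in_keys_iff)
qed

text \<open>The predicate \<open>Q\<close> carries a condition on the occurring words, such as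
  letters in \<open>E\<close> or a fixed length, through the induction; the inductions over the
  tensor algebra and its graded pieces are instances.\<close>

lemma keys_induct [consumes 1, case_names zero monom add]:
  assumes "\<forall>w\<in>Poly_Mapping.keys p. Q (letters w)"
    and "P 0" and "\<And>c u. Q u \<Longrightarrow> P (cst c * wd u)"
    and "\<And>p q. P p \<Longrightarrow> P q \<Longrightarrow> P (p + q)"
  shows "P (p :: 'a word \<Rightarrow>\<^sub>0 complex)"
proof -
  have "P (\<Sum>w\<in>W. Poly_Mapping.single w (Poly_Mapping.lookup p w))"
    if "finite W" "W \<subseteq> Poly_Mapping.keys p" for W
    using that
  proof (induction W rule: finite_induct)
    case (insert w W)
    then have "P (Poly_Mapping.single w (Poly_Mapping.lookup p w))"
      using assms(1,3) unfolding single_eq_cst_wd[of w "Poly_Mapping.lookup p w"] by blast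
    with insert show ?case
      by (simp add: assms(4))
  qed (simp add: assms(2))
  from this[OF finite_keys subset_refl] show ?thesis
    by (simp flip: sum_singles)
qed

lemma pm_induct [case_names zero monom add]:
  assumes "P 0" and "\<And>c u. P (cst c * wd u)"
    and "\<And>p q. P p \<Longrightarrow> P q \<Longrightarrow> P (p + q)"
  shows "P (p :: 'a word \<Rightarrow>\<^sub>0 complex)"
  using keys_induct[of p "\<lambda>_. True" P] assms by blast

text \<open>Words do not commute, but scalars are multiples of the unit and hence central.\<close>

lemma cst_commute: "p * cst c = cst c * (p :: 'a word \<Rightarrow>\<^sub>0 complex)"
  by (induction p rule: pm_induct) (simp_all add: algebra_simps mult_single)

lemma cst_left_commute: "p * (cst c * q) = cst c * (p * (q :: 'a word \<Rightarrow>\<^sub>0 complex))"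
  by (simp add: cst_commute flip: mult.assoc)

section \<open>Linear and multiplicative extensions\<close>

definition lin_ext :: "('a list \<Rightarrow> 'b word \<Rightarrow>\<^sub>0 complex) \<Rightarrow> ('a word \<Rightarrow>\<^sub>0 complex) \<Rightarrow> 'b word \<Rightarrow>\<^sub>0 complex" where
  "lin_ext h p = (\<Sum>w\<in>Poly_Mapping.keys p. cst (Poly_Mapping.lookup p w) * h (letters w))"

text \<open>Cancellation can make the support of \<open>p + q\<close> smaller than the union of the
  supports. Summing over a common finite superset turns additivity into a termwise
  statement.\<close>

lemma lin_ext_superset:
  assumes "finite W" "Poly_Mapping.keys p \<subseteq> W"
  shows "lin_ext h p = (\<Sum>w\<in>W. cst (Poly_Mapping.lookup p w) * h (letters w))"
  unfolding lin_ext_def using assms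
  by (intro sum.mono_neutral_left) (auto simp: in_keys_iff)

lemma lin_ext_add: "lin_ext h (p + q) = lin_ext h p + lin_ext h q"
proof -
  let ?W = "Poly_Mapping.keys p \<union> Poly_Mapping.keys q"
  have "lin_ext h r = (\<Sum>w\<in>?W. cst (Poly_Mapping.lookup r w) * h (letters w))" if "r \<in> {p, q, p + q}" for r
    using that keys_add[of p q] by (intro lin_ext_superset) auto
  then show ?thesis
    by (simp add: lookup_add single_add distrib_right sum.distrib)
qed

lemma lin_ext_zero [simp]: "lin_ext h 0 = 0"
  by (simp add: lin_ext_def)

lemma lin_ext_single: "lin_ext h (Poly_Mapping.single w c) = cst c * h (letters w)"
  by (cases "c = 0") (simp_all add: lin_ext_def)

lemma lin_ext_wd [simp]: "lin_ext h (wd u) = h u"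
  by (simp add: lin_ext_single)

lemma lin_ext_one: "lin_ext h 1 = h []"
  using lin_ext_wd[of h "[]"] by simp

lemma lin_ext_cst_mult: "lin_ext h (cst c * p) = cst c * lin_ext h p"
  by (induction p rule: pm_induct)
     (simp_all add: distrib_left lin_ext_add mult_single lin_ext_single mult.assoc[symmetric])

lemma lin_ext_uminus: "lin_ext h (- p) = - lin_ext h p"
  using lin_ext_add[of h p "- p"] by (simp add: eq_neg_iff_add_eq_0 add.commute)

lemma lin_ext_diff: "lin_ext h (p - q) = lin_ext h p - lin_ext h q"
  using lin_ext_add[of h p "- q"] by (simp add: lin_ext_uminus)

lemma lin_ext_sum: "lin_ext h (sum f A) = (\<Sum>x\<in>A. lin_ext h (f x))"
  by (induction A rule: infinite_finite_induct) (simp_all add: lin_ext_add)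

lemmas lin_ext_simps = lin_ext_add lin_ext_one lin_ext_cst_mult lin_ext_uminus lin_ext_diff lin_ext_sum

text \<open>The homomorphism from the universal property of the tensor algebra: \<open>f\<close>
  prescribes the images of the letters. Isomorphisms of Orlik--Solomon algebras are lifted to such
  substitutions.\<close>

definition alg_ext :: "('a \<Rightarrow> 'b word \<Rightarrow>\<^sub>0 complex) \<Rightarrow> ('a word \<Rightarrow>\<^sub>0 complex) \<Rightarrow> 'b word \<Rightarrow>\<^sub>0 complex" where
  "alg_ext f = lin_ext (\<lambda>u. prod_list (map f u))"

lemma alg_ext_wd [simp]: "alg_ext f (wd u) = prod_list (map f u)"
  by (simp add: alg_ext_def)

lemma alg_ext_simps:
  "alg_ext f 0 = 0" "alg_ext f 1 = 1" "alg_ext f (p + q) = alg_ext f p + alg_ext f q"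
  "alg_ext f (- p) = - alg_ext f p" "alg_ext f (p - q) = alg_ext f p - alg_ext f q"
  "alg_ext f (cst c * p) = cst c * alg_ext f p"
  by (simp_all add: alg_ext_def lin_ext_simps)

lemma alg_ext_mult: "alg_ext f (p * q) = alg_ext f p * alg_ext f q"
proof (induction p rule: pm_induct)
  case (monom c u)
  have "alg_ext f (wd u * q) = alg_ext f (wd u) * alg_ext f q"
  proof (induction q rule: pm_induct)
    case (monom c v)
    then show ?case
      by (simp add: cst_left_commute alg_ext_simps flip: wd_append)
  qed (simp_all add: alg_ext_simps distrib_left)
  then show ?case
    by (simp only: mult.assoc alg_ext_simps)
qed (simp_all add: alg_ext_simps distrib_right)

lemma alg_ext_cst [simp]: "alg_ext f (cst c) = cst c"
  using alg_ext_simps(6)[of f c 1] by (simp add: alg_ext_simps)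

section \<open>Graded pieces of the tensor algebra\<close>

abbreviation tens :: "'a set \<Rightarrow> ('a word \<Rightarrow>\<^sub>0 complex) set" where
  "tens E \<equiv> carrier (tensor_algebra E)"

abbreviation tens_deg :: "'a set \<Rightarrow> nat \<Rightarrow> ('a word \<Rightarrow>\<^sub>0 complex) set" where
  "tens_deg E \<equiv> homog (tensor_algebra E)"

lemma tens_iff: "p \<in> tens E \<longleftrightarrow> (\<forall>w\<in>Poly_Mapping.keys p. set (letters w) \<subseteq> E)"
  by (simp add: tensor_algebra_def)

lemma tens_deg_iff:
  "p \<in> tens_deg E n \<longleftrightarrow> (\<forall>w\<in>Poly_Mapping.keys p. set (letters w) \<subseteq> E \<and> length (letters w) = n)"
  by (simp add: tensor_algebra_def)

lemma tens_deg_subset: "p \<in> tens_deg E n \<Longrightarrow> p \<in> tens E"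
  by (auto simp: tens_iff tens_deg_iff)

lemma keys_uminus_pm [simp]: "Poly_Mapping.keys (- p :: 'a word \<Rightarrow>\<^sub>0 complex) = Poly_Mapping.keys p"
  by (auto simp: in_keys_iff)

lemma tens_zero [simp]: "0 \<in> tens E" and tens_one [simp]: "1 \<in> tens E"
  and tens_cst [simp]: "cst c \<in> tens E"
  and tens_add: "p \<in> tens E \<Longrightarrow> q \<in> tens E \<Longrightarrow> p + q \<in> tens E"
  and tens_uminus: "p \<in> tens E \<Longrightarrow> - p \<in> tens E"
  and tens_wd: "set u \<subseteq> E \<Longrightarrow> wd u \<in> tens E"
  using keys_add[of p q] by (auto simp: tens_iff zero_word_def split: if_splits)

lemma tens_mult: "p \<in> tens E \<Longrightarrow> q \<in> tens E \<Longrightarrow> p * q \<in> tens E"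
  using keys_mult[of p q] unfolding tens_iff plus_word_def by fastforce

lemma tens_diff: "p \<in> tens E \<Longrightarrow> q \<in> tens E \<Longrightarrow> p - q \<in> tens E"
  using tens_add[of p E "- q"] by (simp add: tens_uminus)

lemma tens_sum: "(\<And>x. x \<in> A \<Longrightarrow> f x \<in> tens E) \<Longrightarrow> sum f A \<in> tens E"
  by (induction A rule: infinite_finite_induct) (auto intro: tens_add)

lemmas tens_intros = tens_add tens_uminus tens_wd tens_mult tens_diff tens_sum

lemma tens_deg_zero [simp]: "0 \<in> tens_deg E n"
  and tens_deg_add: "p \<in> tens_deg E n \<Longrightarrow> q \<in> tens_deg E n \<Longrightarrow> p + q \<in> tens_deg E n"
  and tens_deg_uminus: "p \<in> tens_deg E n \<Longrightarrow> - p \<in> tens_deg E n"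
  and tens_deg_wd: "set u \<subseteq> E \<Longrightarrow> length u = n \<Longrightarrow> wd u \<in> tens_deg E n"
  and tens_deg_cst [simp]: "cst c \<in> tens_deg E 0"
  using keys_add[of p q] by (auto simp: tens_deg_iff zero_word_def split: if_splits)

lemma tens_deg_mult: "p \<in> tens_deg E m \<Longrightarrow> q \<in> tens_deg E n \<Longrightarrow> p * q \<in> tens_deg E (m + n)"
  using keys_mult[of p q] unfolding tens_deg_iff plus_word_def by fastforce

lemma tens_deg_cst_mult: "p \<in> tens_deg E n \<Longrightarrow> cst c * p \<in> tens_deg E n"
  using tens_deg_mult[OF tens_deg_cst, of p E n c] by simp

lemma tens_deg_diff: "p \<in> tens_deg E n \<Longrightarrow> q \<in> tens_deg E n \<Longrightarrow> p - q \<in> tens_deg E n"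
  using tens_deg_add[of p E n "- q"] by (simp add: tens_deg_uminus)

lemmas tens_deg_intros = tens_deg_add tens_deg_uminus tens_deg_wd tens_deg_cst_mult tens_deg_diff

lemma tens_induct [consumes 1, case_names zero monom add]:
  assumes "p \<in> tens E"
    and "P 0" and "\<And>c u. set u \<subseteq> E \<Longrightarrow> P (cst c * wd u)"
    and "\<And>p q. P p \<Longrightarrow> P q \<Longrightarrow> P (p + q)"
  shows "P p"
  using keys_induct[of p "\<lambda>u. set u \<subseteq> E" P] assms by (auto simp: tens_iff)

lemma tens_deg_induct [consumes 1, case_names zero monom add]:
  assumes "p \<in> tens_deg E n"
    and "P 0" and "\<And>c u. set u \<subseteq> E \<Longrightarrow> length u = n \<Longrightarrow> P (cst c * wd u)"
    and "\<And>p q. P p \<Longrightarrow> P q \<Longrightarrow> P (p + q)"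
  shows "P p"
  using keys_induct[of p "\<lambda>u. set u \<subseteq> E \<and> length u = n" P] assms by (auto simp: tens_deg_iff)

lemma alg_ext_tens_deg:
  assumes "p \<in> tens_deg E n" "\<And>i. i \<in> E \<Longrightarrow> f i \<in> tens_deg E' 1"
  shows "alg_ext f p \<in> tens_deg E' n"
  using assms(1)
proof (induction rule: tens_deg_induct)
  case (monom c u)
  have "prod_list (map f u) \<in> tens_deg E' (length u)" using monom(1)
  proof (induction u)
    case Nil
    then show ?case using tens_deg_wd[of "[]" E' 0] by simp
  next
    case (Cons i u)
    then show ?case using tens_deg_mult[OF assms(2), of i "prod_list (map f u)" "length u"] by simp
  qed
  with monom show ?case by (simp add: alg_ext_simps tens_deg_cst_mult)
qed (auto simp: alg_ext_simps intro: tens_deg_add)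

lemma alg_ext_tens:
  assumes "p \<in> tens E" "\<And>i. i \<in> E \<Longrightarrow> f i \<in> tens_deg E' 1"
  shows "alg_ext f p \<in> tens E'"
  using assms(1)
proof (induction rule: tens_induct)
  case (monom c u)
  then have "alg_ext f (cst c * wd u) \<in> tens_deg E' (length u)"
    by (intro alg_ext_tens_deg assms(2)) (auto intro: tens_deg_cst_mult tens_deg_wd)
  then show ?case by (rule tens_deg_subset)
qed (auto simp: alg_ext_simps intro: tens_add)

text \<open>Uniqueness in the universal property: both sides are homomorphisms that agree on the
  letters of \<open>E\<close>.\<close>

lemma alg_ext_compose:
  assumes "p \<in> tens E" and "\<And>i. i \<in> E \<Longrightarrow> alg_ext g (f i) = h i"
  shows "alg_ext g (alg_ext f p) = alg_ext h p"
  using assms(1)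
proof (induction rule: tens_induct)
  case (monom c u)
  have "alg_ext g (prod_list (map f u)) = prod_list (map h u)" using monom
    by (induction u) (auto simp: alg_ext_simps alg_ext_mult assms(2))
  then show ?case by (simp add: alg_ext_simps)
qed (auto simp: alg_ext_simps)

lemma prod_list_letters: "(\<Prod>i\<leftarrow>u. wd [h i]) = wd (map h u)"
proof (induction u)
  case (Cons i u)
  then show ?case by (simp only: list.map prod_list.Cons wd_Cons[of "h i" "map h u"])
qed simp

lemma alg_ext_ident: "alg_ext (\<lambda>i. wd [i]) p = p"
  by (induction p rule: pm_induct) (simp_all add: alg_ext_simps prod_list_letters[where h = "\<lambda>i. i"])

section \<open>Antiderivations\<close>

text \<open>Contraction with the linear form taking the value \<open>l i\<close> on the letter
  \<open>i\<close>. Constant weight 1 gives the boundary; other weights arise when a boundary is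
  transported along an isomorphism.\<close>

fun word_der :: "('a \<Rightarrow> complex) \<Rightarrow> 'a list \<Rightarrow> 'a word \<Rightarrow>\<^sub>0 complex" where
  "word_der l [] = 0"
| "word_der l (i # u) = cst (l i) * wd u - wd [i] * word_der l u"

definition der :: "('a \<Rightarrow> complex) \<Rightarrow> ('a word \<Rightarrow>\<^sub>0 complex) \<Rightarrow> 'a word \<Rightarrow>\<^sub>0 complex" where
  "der l = lin_ext (word_der l)"

text \<open>The grade involution, which is the sign (-1)^n in degree n. It allows the graded Leibniz
  rule to be stated for inhomogeneous factors.\<close>

definition sgn_inv :: "('a word \<Rightarrow>\<^sub>0 complex) \<Rightarrow> 'a word \<Rightarrow>\<^sub>0 complex" where
  "sgn_inv = alg_ext (\<lambda>i. - wd [i])"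

lemma der_wd [simp]: "der l (wd u) = word_der l u"
  by (simp add: der_def)

lemma der_simps:
  "der l 0 = 0" "der l 1 = 0" "der l (p + q) = der l p + der l q"
  "der l (- p) = - der l p" "der l (p - q) = der l p - der l q"
  "der l (cst c * p) = cst c * der l p"
  by (simp_all add: der_def lin_ext_simps)

lemma der_mult: "der l (p * q) = der l p * q + sgn_inv p * der l q"
proof (induction p rule: pm_induct)
  case (monom c u)
  have "der l (wd u * q) = word_der l u * q + sgn_inv (wd u) * der l q"
  proof (induction q rule: pm_induct)
    case (monom c v)
    have "word_der l (u @ v) = word_der l u * wd v + sgn_inv (wd u) * word_der l v"
    proof (induction u)
      case (Cons i u)
      then show ?case
        by (simp add: sgn_inv_def alg_ext_simps algebra_simps wd_append)
    qed (simp add: sgn_inv_def alg_ext_simps)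
    then show ?case
      by (simp add: cst_left_commute der_simps distrib_left flip: wd_append)
  qed (simp_all add: der_simps algebra_simps)
  then show ?case
    by (simp add: mult.assoc der_simps sgn_inv_def alg_ext_simps distrib_left)
qed (simp_all add: der_simps sgn_inv_def alg_ext_simps distrib_right)

lemma sgn_inv_tens_deg:
  assumes "p \<in> tens_deg E n"
  shows "sgn_inv p = (-1) ^ n * p"
  using assms
proof (induction rule: tens_deg_induct)
  case (monom c u)
  have "prod_list (map (\<lambda>i. - wd [i]) u) = (-1) ^ length u * wd u"
  proof (induction u)
    case (Cons i u)
    then show ?case
      by (cases "even (length u)") (simp_all add: wd_Cons[of i u])
  qed simp
  with monom show ?case
    by (cases "even n") (simp_all add: sgn_inv_def alg_ext_simps)
qed (simp_all add: sgn_inv_def alg_ext_simps distrib_left)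

lemma der_cst [simp]: "der l (cst c) = 0"
  using der_simps(6)[of l c 1] by (simp add: der_simps)

lemma word_der_tens_deg: "set u \<subseteq> E \<Longrightarrow> length u = Suc n \<Longrightarrow> word_der l u \<in> tens_deg E n"
proof (induction u arbitrary: n)
  case (Cons i u)
  have "wd [i] * word_der l u \<in> tens_deg E n"
  proof (cases n)
    case (Suc m)
    with Cons have "wd [i] \<in> tens_deg E 1" "word_der l u \<in> tens_deg E m"
      by (auto intro: tens_deg_wd)
    then show ?thesis using Suc tens_deg_mult[of "wd [i]" E 1 _ m] by simp
  qed (use Cons in simp)
  with Cons show ?case
    by (auto intro!: tens_deg_intros)
qed simp

lemma der_tens_deg: "p \<in> tens_deg E (Suc n) \<Longrightarrow> der l p \<in> tens_deg E n"
  by (induction p rule: tens_deg_induct)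
     (auto simp: der_simps intro: tens_deg_intros word_der_tens_deg)

lemma der_tens: "p \<in> tens E \<Longrightarrow> der l p \<in> tens E"
proof (induction p rule: tens_induct)
  case (monom c u)
  have "word_der l u \<in> tens E"
  proof (cases u)
    case (Cons i v)
    with monom show ?thesis
      using tens_deg_subset[OF word_der_tens_deg, of u E "length v" l] by simp
  qed simp
  then show ?case
    by (simp add: der_simps tens_mult)
qed (auto simp: der_simps intro: tens_add)

lemma der_degree_one: "p \<in> tens_deg E 1 \<Longrightarrow> \<exists>c. der l p = cst c"
  using der_tens_deg[of p E 0 l]
proof -
  assume "p \<in> tens_deg E 1"
  then show ?thesis
  proof (induction rule: tens_deg_induct)
    case (monom c u)
    then obtain i where "u = [i]" by (auto simp: length_Suc_conv)
    then show ?case by (auto simp: der_simps simp flip: cst_mult)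
  next
    case (add p q)
    then show ?case by (auto simp: der_simps simp flip: single_add)
  qed (auto simp: der_simps intro: exI[of _ 0])
qed

text \<open>This holds already in the tensor algebra: for a word \<open>i # u\<close> the Leibniz
  rule produces \<open>cst (l i) * word_der l u\<close> twice with opposite signs, which leaves
  \<open>wd [i]\<close> times the iterated derivative of \<open>u\<close>.\<close>

lemma der_der: "der l (der l p) = 0"
proof (induction p rule: pm_induct)
  case (monom c u)
  have "der l (word_der l u) = 0"
    by (induction u) (simp_all add: der_simps der_mult sgn_inv_def alg_ext_simps)
  then show ?case by (simp add: der_simps)
qed (simp_all add: der_simps)

lemma der_diff_weight: "der (\<lambda>i. l i - m i) p = der l p - der m p"
proof (induction p rule: pm_induct)
  case (monom c u)
  have "word_der (\<lambda>i. l i - m i) u = word_der l u - word_der m u"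
    by (induction u) (simp_all add: single_diff left_diff_distrib right_diff_distrib)
  then show ?case by (simp add: der_simps right_diff_distrib)
qed (simp_all add: der_simps)

text \<open>Since \<open>der l v\<close> is a scalar c, the Leibniz rule gives c v - v c, and
  scalars are central.\<close>

lemma der_square:
  assumes "v \<in> tens_deg E 1"
  shows "der l (v * v) = 0"
proof -
  obtain c where "der l v = cst c" using der_degree_one[OF assms] by blast
  then show ?thesis
    using sgn_inv_tens_deg[OF assms] by (simp add: der_mult cst_commute)
qed

text \<open>Both sides satisfy the same Leibniz rule along the substitution, because
  \<open>f\<close> preserves degrees and hence signs; so agreement on letters suffices. The weights
  \<open>m\<close> are the pullback of \<open>l\<close> along \<open>f\<close>.\<close>

lemma der_alg_ext:
  assumes "p \<in> tens E" and "\<And>i. i \<in> E \<Longrightarrow> f i \<in> tens_deg E' 1"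
    and "\<And>i. i \<in> E \<Longrightarrow> der l (f i) = cst (m i)"
  shows "der l (alg_ext f p) = alg_ext f (der m p)"
  using assms(1)
proof (induction rule: tens_induct)
  case (monom c u)
  have "der l (prod_list (map f u)) = alg_ext f (word_der m u)" using monom
  proof (induction u)
    case (Cons i u)
    then show ?case
      using assms(3)[of i] sgn_inv_tens_deg[OF assms(2), of i]
      by (simp add: der_mult alg_ext_simps alg_ext_mult)
  qed (simp add: der_simps alg_ext_simps)
  then show ?case by (simp add: alg_ext_simps der_simps)
qed (simp_all add: alg_ext_simps der_simps)

abbreviation bnd :: "'a list \<Rightarrow> 'a word \<Rightarrow>\<^sub>0 complex" where
  "bnd S \<equiv> word_der (\<lambda>_. 1) S"

lemma bnd_eq_sum:
  "bnd S = (\<Sum>k<length S. cst ((-1) ^ k) * wd (take k S @ drop (Suc k) S))"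
proof (induction S)
  case (Cons i S)
  \<comment> \<open>Deleting position k of the tail is deleting position k + 1 of
    \<open>i # S\<close>; the shift accounts for the minus sign in the recursion of
    \<open>word_der\<close>.\<close>
  have *: "cst ((-1) ^ Suc k) * wd (i # v) = - (wd [i] * (cst ((-1) ^ k) * wd v))" for k v
    by (simp add: mult_single plus_word_def zero_word_def single_uminus)
  show ?case
    by (simp add: sum.lessThan_Suc_shift Cons sum_distrib_left * sum_negf
        del: sum.lessThan_Suc power_Suc)
qed simp

section \<open>The Orlik--Solomon ideal in the tensor algebra\<close>

text \<open>The base cases are already two-sided multiples of the generators, so closure under sums
  is enough to make this an ideal. When every set counts as independent, only the squares remain and
  the ideal defines the exterior algebra.\<close>

inductive_set os_ker :: "'a set \<Rightarrow> ('a set \<Rightarrow> bool) \<Rightarrow> ('a word \<Rightarrow>\<^sub>0 complex) set" for E P where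
  zero: "0 \<in> os_ker E P"
| add: "p \<in> os_ker E P \<Longrightarrow> q \<in> os_ker E P \<Longrightarrow> p + q \<in> os_ker E P"
| square: "v \<in> tens_deg E 1 \<Longrightarrow> x \<in> tens E \<Longrightarrow> y \<in> tens E \<Longrightarrow> x * (v * v) * y \<in> os_ker E P"
| boundary: "set S \<subseteq> E \<Longrightarrow> \<not> P (set S) \<Longrightarrow> x \<in> tens E \<Longrightarrow> y \<in> tens E \<Longrightarrow> x * bnd S * y \<in> os_ker E P"

lemma bnd_tens: "set S \<subseteq> E \<Longrightarrow> bnd S \<in> tens E"
  using der_tens[OF tens_wd, of S E "\<lambda>_. 1"] by simp

lemma os_ker_tens: "p \<in> os_ker E P \<Longrightarrow> p \<in> tens E"
  by (induction rule: os_ker.induct) (auto intro!: tens_intros bnd_tens dest: tens_deg_subset)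

lemma os_ker_mult_left: "p \<in> os_ker E P \<Longrightarrow> z \<in> tens E \<Longrightarrow> z * p \<in> os_ker E P"
proof (induction rule: os_ker.induct)
  case (square v x y)
  then show ?case using os_ker.square[of v E "z * x" y P] by (simp add: mult.assoc tens_mult)
next
  case (boundary S x y)
  then show ?case using os_ker.boundary[of S E P "z * x" y] by (simp add: mult.assoc tens_mult)
qed (auto simp: distrib_left intro: os_ker.intros)

lemma os_ker_mult_right: "p \<in> os_ker E P \<Longrightarrow> z \<in> tens E \<Longrightarrow> p * z \<in> os_ker E P"
proof (induction rule: os_ker.induct)
  case (square v x y)
  then show ?case using os_ker.square[of v E x "y * z" P] by (simp add: mult.assoc tens_mult)
next
  case (boundary S x y)
  then show ?case using os_ker.boundary[of S E P x "y * z"] by (simp add: mult.assoc tens_mult)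
qed (auto simp: distrib_right intro: os_ker.intros)

lemma os_ker_cst_mult: "p \<in> os_ker E P \<Longrightarrow> cst c * p \<in> os_ker E P"
  by (simp add: os_ker_mult_left)

lemma os_ker_uminus: "p \<in> os_ker E P \<Longrightarrow> - p \<in> os_ker E P"
  using os_ker_cst_mult[of p E P "-1"] by (simp add: single_uminus)

lemma os_ker_diff: "p \<in> os_ker E P \<Longrightarrow> q \<in> os_ker E P \<Longrightarrow> p - q \<in> os_ker E P"
  using os_ker.add[of p E P "- q"] by (simp add: os_ker_uminus)

lemma os_ker_square: "v \<in> tens_deg E 1 \<Longrightarrow> v * v \<in> os_ker E P"
  using os_ker.square[of v E 1 1] by simp

lemma os_ker_boundary: "set S \<subseteq> E \<Longrightarrow> \<not> P (set S) \<Longrightarrow> bnd S \<in> os_ker E P"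
  using os_ker.boundary[of S E P 1 1] by simp

text \<open>Fewer independent sets give more boundary generators.\<close>

lemma os_ker_mono:
  assumes "p \<in> os_ker E P" and "\<And>X. X \<subseteq> E \<Longrightarrow> P' X \<Longrightarrow> P X"
  shows "p \<in> os_ker E P'"
  using assms(1) by induction (auto intro: os_ker.intros assms(2))

text \<open>Squares of degree-one elements go to squares of degree-one elements, so only the
  boundary generators have to be checked.\<close>

lemma alg_ext_os_ker:
  assumes "p \<in> os_ker E P" and "\<And>i. i \<in> E \<Longrightarrow> f i \<in> tens_deg E' 1"
    and "\<And>S. set S \<subseteq> E \<Longrightarrow> \<not> P (set S) \<Longrightarrow> alg_ext f (bnd S) \<in> os_ker E' P'"
  shows "alg_ext f p \<in> os_ker E' P'"
  using assms(1)
proof induction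
  case (square v x y)
  then show ?case
    by (auto simp: alg_ext_mult intro!: os_ker.square alg_ext_tens_deg alg_ext_tens assms(2))
next
  case (boundary S x y)
  then have "alg_ext f x * alg_ext f (bnd S) * alg_ext f y \<in> os_ker E' P'"
    by (intro os_ker_mult_right os_ker_mult_left[of "alg_ext f (bnd S)"] assms(3) alg_ext_tens[OF _ assms(2)])
  then show ?case by (simp add: alg_ext_mult)
qed (auto simp: alg_ext_simps intro: os_ker.intros)

text \<open>The generators are homogeneous, so the involution changes them at most by a
  sign.\<close>

lemma sgn_inv_os_ker:
  assumes "p \<in> os_ker E P"
  shows "sgn_inv p \<in> os_ker E P"
  unfolding sgn_inv_def
proof (rule alg_ext_os_ker[OF assms])
  fix S assume S: "set S \<subseteq> E" "\<not> P (set S)"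
  show "alg_ext (\<lambda>i. - wd [i]) (bnd S) \<in> os_ker E P"
  proof (cases S)
    case Nil
    then show ?thesis by (simp add: alg_ext_simps os_ker.zero)
  next
    case (Cons i u)
    then have "sgn_inv (bnd S) = (-1) ^ length u * bnd S"
      using S by (intro sgn_inv_tens_deg word_der_tens_deg) auto
    then show ?thesis
      using os_ker_boundary[of S E P] S by (cases "even (length u)") (simp_all add: sgn_inv_def os_ker_uminus)
  qed
qed (simp add: tens_deg_uminus tens_deg_wd)

text \<open>The generators are cycles: squares by \<open>der_square\<close>, boundaries by
  \<open>der_der\<close>. Hence every term that survives in the Leibniz rule for
  \<open>x * g * y\<close> still has the generator as a factor.\<close>

lemma der_os_ker:
  assumes "p \<in> os_ker E P"
  shows "der (\<lambda>_. 1) p \<in> os_ker E P"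
proof -
  have *: "der (\<lambda>_. 1) (x * g * y) \<in> os_ker E P"
    if "x \<in> tens E" "y \<in> tens E" "g \<in> os_ker E P" "der (\<lambda>_. 1) g = 0" for x y g
  proof -
    have "der (\<lambda>_. 1) x * g * y + sgn_inv (x * g) * der (\<lambda>_. 1) y \<in> os_ker E P"
      using that by (intro os_ker.add os_ker_mult_left[of g]
        os_ker_mult_right[of "_ * g"] os_ker_mult_right[of "sgn_inv (x * g)"] sgn_inv_os_ker der_tens)
    with that(4) show ?thesis by (simp add: der_mult)
  qed
  from assms show ?thesis
  proof induction
    case (square v x y)
    then show ?case by (simp add: * os_ker_square der_square)
  next
    case (boundary S x y)
    then show ?case using * der_der[of "\<lambda>_. 1" "wd S"] by (simp add: os_ker_boundary)
  qed (auto simp: der_simps intro: os_ker.intros)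
qed

text \<open>Prepending a letter \<open>i\<close> that already occurs in \<open>S\<close> does not
  change the set of letters. So \<open>bnd (i # S)\<close>, which equals
  \<open>wd S - wd [i] * bnd S\<close>, is a generator as well, and \<open>wd S\<close> can be
  solved for.\<close>

lemma dependent_word_os_ker:
  assumes "set S \<subseteq> E" "\<not> P (set S)" "S \<noteq> []"
  shows "wd S \<in> os_ker E P"
proof -
  from assms(3) obtain i where i: "i \<in> set S" by (cases S) auto
  then have "set (i # S) = set S" by auto
  then have "bnd (i # S) \<in> os_ker E P" using assms by (intro os_ker_boundary) auto
  moreover have "wd [i] * bnd S \<in> os_ker E P"
    using assms i by (intro os_ker_mult_left os_ker_boundary tens_wd) auto
  ultimately show ?thesis
    using os_ker.add by fastforce
qed

text \<open>Polarization of the squares.\<close>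

lemma anticommute_os_ker:
  assumes "v \<in> tens_deg E 1" "w \<in> tens_deg E 1"
  shows "v * w + w * v \<in> os_ker E P"
proof -
  have "v * w + w * v = (v + w) * (v + w) - v * v - w * w"
    by (simp add: algebra_simps)
  also have "\<dots> \<in> os_ker E P"
    by (intro os_ker_diff os_ker_square tens_deg_add assms)
  finally show ?thesis .
qed

text \<open>The first copy of \<open>y\<close> is moved to the right by anticommutation until it
  meets the second one and forms a square.\<close>

lemma repeated_word_os_ker:
  assumes "set u \<subseteq> E" "\<not> distinct u"
  shows "wd u \<in> os_ker E P"
proof -
  obtain xs y ys zs where u: "u = xs @ [y] @ ys @ [y] @ zs"
    using not_distinct_decomp[OF assms(2)] by blast
  have "set ys \<subseteq> E \<Longrightarrow> wd [y] * (wd ys * wd [y]) \<in> os_ker E P"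
  proof (induction ys)
    case Nil
    then show ?case using assms(1) u by (auto intro!: os_ker_square tens_deg_wd)
  next
    case (Cons j ys)
    have "wd [y] * (wd (j # ys) * wd [y]) =
        (wd [y] * wd [j] + wd [j] * wd [y]) * (wd ys * wd [y]) - wd [j] * (wd [y] * (wd ys * wd [y]))"
      unfolding wd_Cons[of j ys] by (simp only: distrib_right distrib_left mult.assoc) simp
    also have "\<dots> \<in> os_ker E P"
      using assms(1) u Cons
      by (intro os_ker_diff os_ker_mult_left[of "wd [y] * (wd ys * wd [y])"]
          os_ker_mult_right[of "wd [y] * wd [j] + wd [j] * wd [y]"] anticommute_os_ker tens_intros tens_deg_wd) auto
    finally show ?case .
  qed
  moreover have "wd u = wd xs * (wd [y] * (wd ys * wd [y])) * wd zs"
    by (simp add: u wd_append[symmetric] del: wd_Nil)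
  ultimately show ?thesis
    using assms(1) u by (simp add: os_ker_mult_left os_ker_mult_right tens_wd)
qed

text \<open>
  Since \<open>w \<and> w = 0\<close>, in a product of factors \<open>e\<^sub>i + m\<^sub>i w\<close> at most one factor \<open>w\<close> survives; moving
  it to the front produces the antiderivation with weights \<open>m\<close>.
\<close>

lemma alg_ext_transvection:
  assumes "p \<in> tens E" and w: "w \<in> tens_deg E 1"
  shows "alg_ext (\<lambda>i. wd [i] + cst (m i) * w) p - (p + w * der m p) \<in> os_ker E P"
  using assms(1)
proof (induction rule: tens_induct)
  case zero
  then show ?case by (simp add: alg_ext_simps der_simps os_ker.zero)
next
  case (add p q)
  from os_ker.add[OF this] show ?case
    by (simp add: alg_ext_simps der_simps algebra_simps)
next
  case (monom c u)
  let ?f = "\<lambda>i. wd [i] + cst (m i) * w"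
  have "alg_ext ?f (wd u) - (wd u + w * der m (wd u)) \<in> os_ker E P" using monom
  proof (induction u)
    case Nil
    then show ?case by (simp add: alg_ext_simps der_simps os_ker.zero)
  next
    case (Cons i u)
    let ?q = "alg_ext ?f (wd u) - (wd u + w * der m (wd u))"
    have i: "wd [i] \<in> tens_deg E 1" "wd [i] \<in> tens E" and D: "der m (wd u) \<in> tens E"
      using Cons by (auto intro!: tens_wd tens_deg_wd der_tens simp del: der_wd)
    have "alg_ext ?f (wd (i # u)) - (wd (i # u) + w * der m (wd (i # u))) =
        ?f i * ?q + (wd [i] * w + w * wd [i]) * der m (wd u) + cst (m i) * (w * w) * der m (wd u)"
      unfolding wd_Cons[of i u] by (simp add: der_mult alg_ext_mult sgn_inv_def algebra_simps cst_left_commute)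
    also have "\<dots> \<in> os_ker E P"
      using Cons i D w
      by (intro os_ker.add os_ker_mult_left[of ?q] os_ker_mult_right anticommute_os_ker
          os_ker_cst_mult os_ker_square) (auto intro!: tens_intros dest: tens_deg_subset)
    finally show ?case .
  qed
  from os_ker_cst_mult[OF this, of c] show ?case
    by (simp only: alg_ext_simps der_simps right_diff_distrib distrib_left cst_left_commute)
qed

text \<open>Here simplicity enters: a dependent set has at least three elements, so its boundary has
  degree at least two. Consequently the algebra has no relations in degree one, and degree-one
  elements lift uniquely to the tensor algebra.\<close>

lemma os_ker_degree:
  assumes "p \<in> os_ker E P" and "\<And>X. X \<subseteq> E \<Longrightarrow> card X \<le> 2 \<Longrightarrow> P X"
  shows "\<forall>w\<in>Poly_Mapping.keys p. 2 \<le> length (letters w)"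
proof -
  have mult: "\<forall>w\<in>Poly_Mapping.keys (x * g * y). 2 \<le> length (letters w)"
    if "\<forall>w\<in>Poly_Mapping.keys g. 2 \<le> length (letters w)" for x g y :: "'a word \<Rightarrow>\<^sub>0 complex"
    using that keys_mult[of "x * g" y] keys_mult[of x g] by (fastforce simp: plus_word_def)
  from assms(1) show ?thesis
  proof induction
    case (add p q)
    then show ?case using keys_add[of p q] by blast
  next
    case (square v x y)
    then have "v * v \<in> tens_deg E (1 + 1)" by (intro tens_deg_mult)
    then show ?case by (intro mult) (simp add: tens_deg_iff)
  next
    case (boundary S x y)
    then have "card (set S) \<ge> 3" using assms(2)[of "set S"] by fastforce
    then have S: "length S \<ge> 3" using card_length[of S] by linarith
    then have "bnd S \<in> tens_deg E (length S - 1)"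
      using boundary by (intro word_der_tens_deg) auto
    with S show ?case by (intro mult) (auto simp: tens_deg_iff)
  qed simp
qed

lemma os_ker_degree_one:
  assumes "p \<in> os_ker E P" "p \<in> tens_deg E 1" and "\<And>X. X \<subseteq> E \<Longrightarrow> card X \<le> 2 \<Longrightarrow> P X"
  shows "p = 0"
proof -
  have "Poly_Mapping.keys p = {}"
    using os_ker_degree[OF assms(1,3)] assms(2) by (fastforce simp: tens_deg_iff)
  then show ?thesis by (simp add: poly_mapping_eqI in_keys_iff)
qed

section \<open>Quotients of graded algebras\<close>

text \<open>\<open>graded_Quot\<close> copies the ring operations of \<open>Quot\<close> into
  another record type; the ring axioms see only the five copied fields.\<close>

lemma ring_cong:
  fixes R :: "('b, 'm) ring_scheme" and S :: "('b, 'n) ring_scheme"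
  assumes "ring R" and "carrier S = carrier R" "mult S = mult R" "one S = one R"
    "zero S = zero R" "add S = add R"
  shows "ring S"
proof -
  interpret ring R by fact
  show ?thesis
  proof (rule ringI)
    show "abelian_group S"
    proof (rule abelian_groupI)
      fix x assume "x \<in> carrier S"
      then show "\<exists>y\<in>carrier S. y \<oplus>\<^bsub>S\<^esub> x = \<zero>\<^bsub>S\<^esub>"
        using l_neg[of x] by (auto simp: assms(2-) intro!: bexI[of _ "\<ominus>\<^bsub>R\<^esub> x"])
    qed (simp_all add: assms(2-) a_ac)
    show "Group.monoid S"
      by (rule monoidI) (simp_all add: assms(2-) m_assoc)
  qed (simp_all add: assms(2-) l_distr r_distr)
qed

text \<open>Scalars act as multiplication by multiples of one. This makes the action well defined on
  cosets and is inherited by quotients, so it can be used for both quotients in turn.\<close>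

definition scalar_ring :: "('k, 'b) graded_algebra \<Rightarrow> bool" where
  "scalar_ring A \<longleftrightarrow> ring A \<and> (\<forall>c. c \<odot>\<^bsub>A\<^esub> \<one>\<^bsub>A\<^esub> \<in> carrier A) \<and>
    (\<forall>c. \<forall>x\<in>carrier A. c \<odot>\<^bsub>A\<^esub> x = (c \<odot>\<^bsub>A\<^esub> \<one>\<^bsub>A\<^esub>) \<otimes>\<^bsub>A\<^esub> x)"

lemma scalar_ringD:
  assumes "scalar_ring A"
  shows "ring A" and "c \<odot>\<^bsub>A\<^esub> \<one>\<^bsub>A\<^esub> \<in> carrier A"
    and "x \<in> carrier A \<Longrightarrow> c \<odot>\<^bsub>A\<^esub> x = (c \<odot>\<^bsub>A\<^esub> \<one>\<^bsub>A\<^esub>) \<otimes>\<^bsub>A\<^esub> x"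
  using assms unfolding scalar_ring_def by blast+

context
  fixes A :: "('k, 'b) graded_algebra" and I
  assumes A: "scalar_ring A" and I: "ideal I A"
begin

interpretation ideal I A by (rule I)

lemma graded_Quot_fields:
  "carrier (graded_Quot A I) = (\<lambda>x. I +>\<^bsub>A\<^esub> x) ` carrier A"
  "\<one>\<^bsub>graded_Quot A I\<^esub> = I +>\<^bsub>A\<^esub> \<one>\<^bsub>A\<^esub>"
  "\<zero>\<^bsub>graded_Quot A I\<^esub> = I +>\<^bsub>A\<^esub> \<zero>\<^bsub>A\<^esub>"
  "homog (graded_Quot A I) n = (\<lambda>x. I +>\<^bsub>A\<^esub> x) ` homog A n"
  using a_coset_add_zero[OF a_subset]
  by (auto simp: graded_Quot_def FactRing_simps)

lemma graded_Quot_mult: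
  "x \<in> carrier A \<Longrightarrow> y \<in> carrier A \<Longrightarrow>
    (I +>\<^bsub>A\<^esub> x) \<otimes>\<^bsub>graded_Quot A I\<^esub> (I +>\<^bsub>A\<^esub> y) = I +>\<^bsub>A\<^esub> (x \<otimes>\<^bsub>A\<^esub> y)"
  by (simp add: graded_Quot_def FactRing_def rcoset_mult_add)

lemma graded_Quot_add:
  "x \<in> carrier A \<Longrightarrow> y \<in> carrier A \<Longrightarrow>
    (I +>\<^bsub>A\<^esub> x) \<oplus>\<^bsub>graded_Quot A I\<^esub> (I +>\<^bsub>A\<^esub> y) = I +>\<^bsub>A\<^esub> (x \<oplus>\<^bsub>A\<^esub> y)"
  by (simp add: graded_Quot_def FactRing_def a_rcos_sum)

lemma coset_eq_iff:
  "x \<in> carrier A \<Longrightarrow> y \<in> carrier A \<Longrightarrow> I +>\<^bsub>A\<^esub> x = I +>\<^bsub>A\<^esub> y \<longleftrightarrow> x \<ominus>\<^bsub>A\<^esub> y \<in> I"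
  using quotient_eq_iff_same_a_r_cos[OF I] by blast

lemma smult_closed: "x \<in> carrier A \<Longrightarrow> c \<odot>\<^bsub>A\<^esub> x \<in> carrier A"
  by (subst scalar_ringD(3)[OF A]) (auto intro: m_closed scalar_ringD(2)[OF A])

lemma graded_Quot_smult:
  assumes x: "x \<in> carrier A"
  shows "c \<odot>\<^bsub>graded_Quot A I\<^esub> (I +>\<^bsub>A\<^esub> x) = I +>\<^bsub>A\<^esub> (c \<odot>\<^bsub>A\<^esub> x)"
proof -
  \<comment> \<open>The scalar action on a coset is a union over its representatives; all members of
    that union are the same coset.\<close>
  have "I +>\<^bsub>A\<^esub> (c \<odot>\<^bsub>A\<^esub> y) = I +>\<^bsub>A\<^esub> (c \<odot>\<^bsub>A\<^esub> x)" if "y \<in> I +>\<^bsub>A\<^esub> x" for y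
  proof -
    have y: "y \<in> carrier A"
      by (rule subsetD[OF a_r_coset_subset_G[OF a_subset x] that])
    have yx: "I +>\<^bsub>A\<^esub> y = I +>\<^bsub>A\<^esub> x"
      by (rule a_repr_independence'[OF that x, symmetric])
    have c: "c \<odot>\<^bsub>A\<^esub> \<one>\<^bsub>A\<^esub> \<in> carrier A"
      by (rule scalar_ringD(2)[OF A])
    note eq = scalar_ringD(3)[OF A]
    show ?thesis
      by (simp only: eq[OF x] eq[OF y] yx graded_Quot_mult[OF c x, symmetric]
          graded_Quot_mult[OF c y, symmetric])
  qed
  then have "(\<Union>y\<in>I +>\<^bsub>A\<^esub> x. I +>\<^bsub>A\<^esub> (c \<odot>\<^bsub>A\<^esub> y)) = I +>\<^bsub>A\<^esub> (c \<odot>\<^bsub>A\<^esub> x)"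
    using a_rcos_self[OF x] by (intro SUP_eq_const) blast+
  then show ?thesis
    by (simp only: graded_Quot_def module.simps)
qed

lemma ring_graded_Quot: "ring (graded_Quot A I)"
  by (rule ring_cong[OF quotient_is_ring]) (simp_all add: graded_Quot_def)

lemma scalar_ring_graded_Quot: "scalar_ring (graded_Quot A I)"
  unfolding scalar_ring_def
proof (intro conjI allI ballI ring_graded_Quot)
  let ?B = "graded_Quot A I"
  fix c X
  show "c \<odot>\<^bsub>?B\<^esub> \<one>\<^bsub>?B\<^esub> \<in> carrier ?B"
    by (simp add: graded_Quot_fields graded_Quot_smult smult_closed)
  assume "X \<in> carrier ?B"
  then obtain x where x: "X = I +>\<^bsub>A\<^esub> x" "x \<in> carrier A"
    by (auto simp: graded_Quot_fields)
  show "c \<odot>\<^bsub>?B\<^esub> X = (c \<odot>\<^bsub>?B\<^esub> \<one>\<^bsub>?B\<^esub>) \<otimes>\<^bsub>?B\<^esub> X"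
    using x(2) scalar_ringD(3)[OF A x(2), of c]
    by (simp add: x(1) graded_Quot_fields graded_Quot_smult graded_Quot_mult smult_closed)
qed

end

section \<open>The Orlik--Solomon algebra as a quotient of the tensor algebra\<close>

lemma tensor_algebra_fields [simp]:
  "mult (tensor_algebra E) = (*)" "one (tensor_algebra E) = 1" "zero (tensor_algebra E) = 0"
  "add (tensor_algebra E) = (+)" "smult (tensor_algebra E) c p = cst c * p"
  by (simp_all add: tensor_algebra_def mult_map_scale_conv_mult)

lemma ring_tensor_algebra: "ring (tensor_algebra E)"
proof (rule ringI)
  show "abelian_group (tensor_algebra E)"
  proof (rule abelian_groupI)
    fix x assume "x \<in> tens E"
    then show "\<exists>y\<in>tens E. y \<oplus>\<^bsub>tensor_algebra E\<^esub> x = \<zero>\<^bsub>tensor_algebra E\<^esub>"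
      by (intro bexI[of _ "- x"]) (auto intro: tens_uminus)
  qed (auto intro: tens_add simp: algebra_simps)
  show "Group.monoid (tensor_algebra E)"
    by (rule monoidI) (auto intro: tens_mult simp: mult.assoc)
qed (auto simp: algebra_simps)

lemma scalar_ring_tensor_algebra: "scalar_ring (tensor_algebra E)"
  by (simp add: scalar_ring_def ring_tensor_algebra)

lemma a_minus_tensor_algebra:
  assumes "x \<in> tens E" "y \<in> tens E"
  shows "x \<ominus>\<^bsub>tensor_algebra E\<^esub> y = x - y"
proof -
  interpret ring "tensor_algebra E" by (rule ring_tensor_algebra)
  show ?thesis
    using minus_equality[of "- y" y] assms by (simp add: a_minus_def tens_uminus)
qed

lemma ideal_tensor_algebraI:
  assumes "J \<subseteq> tens E" "0 \<in> J" "\<And>p q. p \<in> J \<Longrightarrow> q \<in> J \<Longrightarrow> p + q \<in> J"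
    "\<And>p. p \<in> J \<Longrightarrow> - p \<in> J"
    "\<And>p x. p \<in> J \<Longrightarrow> x \<in> tens E \<Longrightarrow> x * p \<in> J" "\<And>p x. p \<in> J \<Longrightarrow> x \<in> tens E \<Longrightarrow> p * x \<in> J"
  shows "ideal J (tensor_algebra E)"
proof (rule idealI[OF ring_tensor_algebra])
  interpret ring "tensor_algebra E" by (rule ring_tensor_algebra)
  show "subgroup J (add_monoid (tensor_algebra E))"
  proof (rule group.subgroupI)
    show "group (add_monoid (tensor_algebra E))" by (rule add.is_group)
    fix p assume "p \<in> J"
    moreover from this have "inv\<^bsub>add_monoid (tensor_algebra E)\<^esub> p = - p"
      using minus_equality[of "- p" p] assms(1,4) by (auto simp: a_inv_def)
    ultimately show "inv\<^bsub>add_monoid (tensor_algebra E)\<^esub> p \<in> J" using assms(4) by simp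
  qed (use assms in auto)
qed (use assms in auto)

lemma os_ker_ideal: "ideal (os_ker E P) (tensor_algebra E)"
  by (rule ideal_tensor_algebraI)
     (auto intro: os_ker_tens os_ker.zero os_ker.add os_ker_uminus os_ker_mult_left os_ker_mult_right)

lemma ideal_add_closed:
  "ideal J R \<Longrightarrow> a \<in> J \<Longrightarrow> b \<in> J \<Longrightarrow> a \<oplus>\<^bsub>R\<^esub> b \<in> J"
  by (simp add: additive_subgroup.a_closed ideal_def)

lemma exterior_ideal_eq: "exterior_ideal E = os_ker E (\<lambda>_. True)"
proof
  interpret ring "tensor_algebra E" by (rule ring_tensor_algebra)
  let ?S = "{v \<otimes>\<^bsub>tensor_algebra E\<^esub> v |v. v \<in> tens_deg E 1}"
  have S: "?S \<subseteq> tens E"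
    using tens_mult tens_deg_subset by auto blast
  show "exterior_ideal E \<subseteq> os_ker E (\<lambda>_. True)"
    unfolding exterior_ideal_def
    by (rule genideal_minimal[OF os_ker_ideal]) (auto intro: os_ker_square)
  have ideal: "ideal (exterior_ideal E) (tensor_algebra E)"
    unfolding exterior_ideal_def by (rule genideal_ideal[OF S])
  show "os_ker E (\<lambda>_. True) \<subseteq> exterior_ideal E"
  proof
    fix p assume "p \<in> os_ker E (\<lambda>_. True)"
    then show "p \<in> exterior_ideal E"
    proof induction
      case zero
      then show ?case
        using additive_subgroup.zero_closed[OF ideal.axioms(1)[OF ideal]] by simp
    next
      case (add p q)
      then show ?case using ideal_add_closed[OF ideal, of p q] by simp
    next
      case (square v x y)
      have "v * v \<in> exterior_ideal E"
        unfolding exterior_ideal_def using genideal_self[OF S] square(1) by auto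
      then show ?case
        using square ideal.I_l_closed[OF ideal, of "v * v" x] ideal.I_r_closed[OF ideal, of "x * (v * v)" y]
        by simp
    qed simp
  qed
qed

abbreviation ext_proj :: "'a set \<Rightarrow> ('a word \<Rightarrow>\<^sub>0 complex) \<Rightarrow> ('a word \<Rightarrow>\<^sub>0 complex) set" where
  "ext_proj E p \<equiv> exterior_ideal E +>\<^bsub>tensor_algebra E\<^esub> p"

lemmas ext_quot =
  scalar_ring_tensor_algebra os_ker_ideal[of E "\<lambda>_. True" for E, folded exterior_ideal_eq]

lemmas ext_fields = graded_Quot_fields[OF ext_quot, folded exterior_algebra_def]
lemmas ext_mult = graded_Quot_mult[OF ext_quot, folded exterior_algebra_def, simplified]
lemmas ext_add = graded_Quot_add[OF ext_quot, folded exterior_algebra_def, simplified]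
lemmas ext_smult = graded_Quot_smult[OF ext_quot, folded exterior_algebra_def, simplified]
lemmas scalar_ring_ext = scalar_ring_graded_Quot[OF ext_quot, folded exterior_algebra_def]

lemma ring_ext: "ring (exterior_algebra E)"
  by (rule scalar_ringD(1)[OF scalar_ring_ext])

lemma ext_proj_eq_iff:
  "p \<in> tens E \<Longrightarrow> q \<in> tens E \<Longrightarrow> ext_proj E p = ext_proj E q \<longleftrightarrow> p - q \<in> exterior_ideal E"
  using coset_eq_iff[OF ext_quot, of p E q] by (simp add: a_minus_tensor_algebra)

lemma ext_minus:
  assumes "p \<in> tens E" "q \<in> tens E"
  shows "ext_proj E p \<ominus>\<^bsub>exterior_algebra E\<^esub> ext_proj E q = ext_proj E (p - q)"
proof -
  interpret ring "exterior_algebra E" by (rule ring_ext)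
  show ?thesis
    using minus_equality[of "ext_proj E (- q)" "ext_proj E q"] assms
    by (simp add: a_minus_def ext_add ext_fields tens_uminus)
qed

lemma ext_monom_eq: "set S \<subseteq> E \<Longrightarrow> ext_monom E S = ext_proj E (wd S)"
proof (induction S)
  case Nil
  then show ?case by (simp add: ext_monom_def ext_fields)
next
  case (Cons i S)
  then show ?case
    using ext_mult[of "wd [i]" E "wd S"]
    by (simp add: ext_monom_def ext_gen_def tens_wd wd_Cons[of i S])
qed

lemma ext_finsum:
  assumes "finite K" "\<And>k. k \<in> K \<Longrightarrow> f k \<in> tens E"
  shows "(\<Oplus>\<^bsub>exterior_algebra E\<^esub> k \<in> K. ext_proj E (f k)) = ext_proj E (sum f K)"
proof -
  interpret ring "exterior_algebra E" by (rule ring_ext)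
  show ?thesis
    using assms
  proof (induction K rule: finite_induct)
    case empty
    then show ?case by (simp add: ext_fields)
  next
    case (insert k K)
    then show ?case
      by (subst finsum_insert) (auto simp: ext_fields ext_add tens_sum)
  qed
qed

lemma ext_boundary_eq:
  assumes "set S \<subseteq> E"
  shows "ext_boundary E S = ext_proj E (bnd S)"
proof -
  interpret ring "exterior_algebra E" by (rule ring_ext)
  have sub: "set (take k S @ drop (Suc k) S) \<subseteq> E" for k
    using assms set_take_subset[of k S] set_drop_subset[of "Suc k" S] by auto
  have "ext_boundary E S = (\<Oplus>\<^bsub>exterior_algebra E\<^esub> k \<in> {..<length S}.
      ext_proj E (cst ((-1) ^ k) * wd (take k S @ drop (Suc k) S)))"
    unfolding ext_boundary_def
    by (intro finsum_cong') (auto simp only: ext_monom_eq[OF sub] ext_smult[OF tens_wd[OF sub]] ext_fields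
        intro!: imageI tens_mult tens_cst tens_wd sub)
  also have "\<dots> = ext_proj E (bnd S)"
    unfolding bnd_eq_sum by (intro ext_finsum) (auto intro!: tens_mult tens_cst tens_wd sub simp only:)
  finally show ?thesis .
qed

text \<open>The image of an ideal under a surjective projection. Minimality of the generated ideal
  then bounds \<open>os_ideal\<close> from above.\<close>

lemma ext_proj_os_ker_ideal: "ideal (ext_proj E ` os_ker E P) (exterior_algebra E)"
proof (rule idealI[OF ring_ext])
  interpret ring "exterior_algebra E" by (rule ring_ext)
  show "subgroup (ext_proj E ` os_ker E P) (add_monoid (exterior_algebra E))"
  proof (rule group.subgroupI)
    show "group (add_monoid (exterior_algebra E))" by (rule add.is_group)
    show "ext_proj E ` os_ker E P \<noteq> {}" using os_ker.zero by auto
    fix X assume "X \<in> ext_proj E ` os_ker E P"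
    then obtain p where p: "X = ext_proj E p" "p \<in> os_ker E P" by auto
    then have "inv\<^bsub>add_monoid (exterior_algebra E)\<^esub> X = ext_proj E (- p)"
      using minus_equality[of "ext_proj E (- p)" X] os_ker_tens[OF p(2)]
      by (auto simp: a_inv_def ext_add ext_fields tens_uminus)
    with p show "inv\<^bsub>add_monoid (exterior_algebra E)\<^esub> X \<in> ext_proj E ` os_ker E P"
      by (auto intro: os_ker_uminus)
  next
    fix X Y assume "X \<in> ext_proj E ` os_ker E P" "Y \<in> ext_proj E ` os_ker E P"
    then show "X \<otimes>\<^bsub>add_monoid (exterior_algebra E)\<^esub> Y \<in> ext_proj E ` os_ker E P"
      by (auto simp: ext_add os_ker_tens intro: os_ker.add)
  qed (auto simp: ext_fields os_ker_tens)
qed (auto simp: ext_fields ext_mult os_ker_tens intro: os_ker_mult_left os_ker_mult_right)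

lemma os_ideal_generators:
  "{ext_boundary E S |S. set S \<subseteq> E \<and> \<not> P (set S)} = ext_proj E ` {bnd S |S. set S \<subseteq> E \<and> \<not> P (set S)}"
proof -
  have "ext_boundary E ` {S. set S \<subseteq> E \<and> \<not> P (set S)} = (\<lambda>S. ext_proj E (bnd S)) ` {S. set S \<subseteq> E \<and> \<not> P (set S)}"
    by (rule image_cong) (simp_all add: ext_boundary_eq)
  then show ?thesis
    by (simp add: setcompr_eq_image image_image)
qed

lemma os_ideal_ideal: "ideal (os_ideal E P) (exterior_algebra E)"
  unfolding os_ideal_def os_ideal_generators
  by (rule ring.genideal_ideal[OF ring_ext]) (auto simp: ext_fields intro: bnd_tens)

text \<open>\<open>os_ker\<close> is the full preimage of the Orlik--Solomon ideal. For the harder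
  direction, a class in the ideal is also the class of some \<open>q\<close> in
  \<open>os_ker\<close>; then \<open>p - q\<close> lies in the exterior ideal, which is contained in
  \<open>os_ker\<close>.\<close>

lemma ext_proj_mem_os_ideal_iff:
  assumes "p \<in> tens E"
  shows "ext_proj E p \<in> os_ideal E P \<longleftrightarrow> p \<in> os_ker E P"
proof
  assume "p \<in> os_ker E P"
  then show "ext_proj E p \<in> os_ideal E P"
  proof induction
    case zero
    then show ?case
      using additive_subgroup.zero_closed[OF ideal.axioms(1)[OF os_ideal_ideal]] by (simp add: ext_fields)
  next
    case (add p q)
    then show ?case using ideal_add_closed[OF os_ideal_ideal, of "ext_proj E p" E P "ext_proj E q"]
      by (simp add: ext_add os_ker_tens)
  next
    case (square v x y)
    then have "x * (v * v) * y \<in> os_ker E (\<lambda>_. True)" by (rule os_ker.square)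
    then have "ext_proj E (x * (v * v) * y) = ext_proj E 0"
      by (subst ext_proj_eq_iff) (auto simp: exterior_ideal_eq os_ker_tens)
    then show ?case
      using additive_subgroup.zero_closed[OF ideal.axioms(1)[OF os_ideal_ideal]] by (simp add: ext_fields)
  next
    case (boundary S x y)
    have "ext_proj E (bnd S) \<in> os_ideal E P"
      unfolding os_ideal_def os_ideal_generators
      by (rule subsetD[OF ring.genideal_self[OF ring_ext]])
         (use boundary in \<open>auto simp: ext_fields intro: bnd_tens\<close>)
    then have "ext_proj E x \<otimes>\<^bsub>exterior_algebra E\<^esub> ext_proj E (bnd S) \<otimes>\<^bsub>exterior_algebra E\<^esub> ext_proj E y
        \<in> os_ideal E P"
      using boundary
      by (intro ideal.I_l_closed[OF os_ideal_ideal] ideal.I_r_closed[OF os_ideal_ideal]) (auto simp: ext_fields)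
    then show ?case
      using boundary by (simp add: ext_mult bnd_tens tens_mult)
  qed
next
  assume "ext_proj E p \<in> os_ideal E P"
  moreover have "os_ideal E P \<subseteq> ext_proj E ` os_ker E P"
    unfolding os_ideal_def os_ideal_generators
    by (rule ring.genideal_minimal[OF ring_ext ext_proj_os_ker_ideal]) (auto intro: os_ker_boundary)
  ultimately obtain q where q: "ext_proj E p = ext_proj E q" "q \<in> os_ker E P" by auto
  then have "p - q \<in> exterior_ideal E"
    using ext_proj_eq_iff[OF assms os_ker_tens] by blast
  then have "p - q \<in> os_ker E (\<lambda>_. True)"
    by (simp only: exterior_ideal_eq)
  then have "p - q \<in> os_ker E P" by (rule os_ker_mono) simp
  from os_ker.add[OF this q(2)] show "p \<in> os_ker E P" by simp
qed

text \<open>The composite of the two quotient maps. Its kernel is \<open>os_ker\<close>, so the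
  Orlik--Solomon algebra can be treated as a single quotient of the tensor algebra.\<close>

definition os_proj ::
    "'a set \<Rightarrow> ('a set \<Rightarrow> bool) \<Rightarrow> ('a word \<Rightarrow>\<^sub>0 complex) \<Rightarrow> ('a word \<Rightarrow>\<^sub>0 complex) set set" where
  "os_proj E P p = os_ideal E P +>\<^bsub>exterior_algebra E\<^esub> ext_proj E p"

lemmas os_quot = scalar_ring_ext os_ideal_ideal

lemma os_algebra_fields:
  "carrier (os_algebra E P) = os_proj E P ` tens E"
  "\<one>\<^bsub>os_algebra E P\<^esub> = os_proj E P 1"
  "homog (os_algebra E P) n = os_proj E P ` tens_deg E n"
  by (simp_all add: os_algebra_def graded_Quot_fields[OF os_quot] ext_fields os_proj_def image_image)

context
  fixes E :: "'a set" and P :: "'a set \<Rightarrow> bool" and p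
  assumes p: "p \<in> tens E"
begin

lemma os_proj_smult: "c \<odot>\<^bsub>os_algebra E P\<^esub> os_proj E P p = os_proj E P (cst c * p)"
  using p by (simp add: os_proj_def os_algebra_def graded_Quot_smult[OF os_quot] ext_fields ext_smult)

lemma os_proj_mult:
  "q \<in> tens E \<Longrightarrow> os_proj E P p \<otimes>\<^bsub>os_algebra E P\<^esub> os_proj E P q = os_proj E P (p * q)"
  using p by (simp add: os_proj_def os_algebra_def graded_Quot_mult[OF os_quot] ext_fields ext_mult)

lemma os_proj_add:
  "q \<in> tens E \<Longrightarrow> os_proj E P p \<oplus>\<^bsub>os_algebra E P\<^esub> os_proj E P q = os_proj E P (p + q)"
  using p by (simp add: os_proj_def os_algebra_def graded_Quot_add[OF os_quot] ext_fields ext_add)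

lemma os_proj_eq_iff: "q \<in> tens E \<Longrightarrow> os_proj E P p = os_proj E P q \<longleftrightarrow> p - q \<in> os_ker E P"
  using p by (simp add: os_proj_def coset_eq_iff[OF os_quot] ext_fields ext_minus
      ext_proj_mem_os_ideal_iff tens_diff)

end

lemmas os_proj_simps = os_proj_smult os_proj_mult os_proj_add os_proj_eq_iff

section \<open>Monomials of independent sets do not vanish\<close>

context matroid
begin

lemma finite_indep: "indep X \<Longrightarrow> finite X"
  using indep_subset_ground finite_ground finite_subset by blast

lemma augment_to_card:
  assumes "indep X" "indep Z" "card X \<le> card Z"
  shows "\<exists>W. X \<subseteq> W \<and> W \<subseteq> X \<union> Z \<and> indep W \<and> card W = card Z"
  using assms
proof (induction "card Z - card X" arbitrary: X)
  case 0
  then show ?case by (intro exI[of _ X]) auto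
next
  case (Suc n)
  then have "card X < card Z" by linarith
  with Suc.prems obtain y where y: "y \<in> Z - X" "indep (insert y X)"
    using augmentation[of X Z] by blast
  have "card (insert y X) = Suc (card X)"
    using y finite_indep[OF Suc.prems(1)] by simp
  with Suc y have "\<exists>W. insert y X \<subseteq> W \<and> W \<subseteq> insert y X \<union> Z \<and> indep W \<and> card W = card Z"
    by (intro Suc.hyps(1)) auto
  with y show ?case by auto
qed

text \<open>\<open>X\<close> lies in the closure of \<open>Y\<close> and \<open>x\<close> does not.
  Extend \<open>X\<close> inside \<open>X \<union> insert x Y\<close> to an independent
  \<open>W\<close> with one element more than \<open>Y\<close>. Some element of \<open>W\<close>
  augments \<open>Y\<close>; it cannot belong to \<open>X\<close>, so it is
  \<open>x\<close>.\<close>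

lemma indep_insert_outside_closure:
  assumes X: "indep X" and xY: "indep (insert x Y)" "x \<notin> Y"
    and closure: "\<And>y. y \<in> X \<Longrightarrow> y \<in> Y \<or> \<not> indep (insert y Y)"
  shows "indep (insert x X)"
proof -
  have Y: "indep Y" using indep_subset[OF xY(1)] by auto
  have card: "card (insert x Y) = Suc (card Y)"
    using xY finite_indep[OF Y] by simp
  have "card X \<le> card Y"
    using augmentation[OF Y X] closure by (meson DiffD1 DiffD2 not_le)
  then obtain W where W: "X \<subseteq> W" "W \<subseteq> X \<union> insert x Y" "indep W" "card W = Suc (card Y)"
    using augment_to_card[OF X xY(1)] card by auto
  obtain y where "y \<in> W - Y" "indep (insert y Y)"
    using augmentation[OF Y W(3)] W(4) by auto
  then have "x \<in> W" using W(2) closure by auto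
  then show ?thesis using indep_subset[OF W(3)] W(1) by auto
qed

text \<open>
  The sublevel sets of \<open>flag_level B\<close> are the closures of the initial segments of \<open>B\<close>, a flag of
  flats; elements outside the closure of \<open>B\<close> get level \<open>length B\<close>.
\<close>

definition flag_level :: "'a list \<Rightarrow> 'a \<Rightarrow> nat" where
  "flag_level B x = (LEAST k. k = length B \<or> x \<in> set (take (Suc k) B) \<or> \<not> indep (insert x (set (take (Suc k) B))))"

lemma flag_level_prop:
  "flag_level B x = length B \<or> x \<in> set (take (Suc (flag_level B x)) B) \<or>
    \<not> indep (insert x (set (take (Suc (flag_level B x)) B)))"
  unfolding flag_level_def by (rule LeastI[of _ "length B"]) simp

lemma below_flag_level:
  "k < flag_level B x \<Longrightarrow> k \<noteq> length B \<and> x \<notin> set (take (Suc k) B) \<and> indep (insert x (set (take (Suc k) B)))"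
  unfolding flag_level_def using not_less_Least by blast

lemma flag_level_le: "flag_level B x \<le> length B"
  unfolding flag_level_def by (rule Least_le) simp

lemma flag_level_nth:
  assumes "indep (set B)" "distinct B" "k < length B"
  shows "flag_level B (B ! k) = k"
  unfolding flag_level_def
proof (rule Least_equality)
  show "k = length B \<or> B ! k \<in> set (take (Suc k) B) \<or> \<not> indep (insert (B ! k) (set (take (Suc k) B)))"
    using assms(3) by (auto simp: take_Suc_conv_app_nth)
  fix j assume j: "j = length B \<or> B ! k \<in> set (take (Suc j) B) \<or> \<not> indep (insert (B ! k) (set (take (Suc j) B)))"
  show "k \<le> j"
  proof (rule ccontr)
    assume "\<not> k \<le> j"
    then have "B ! k \<notin> set (take (Suc j) B)"
      using assms(2,3) by (auto simp: in_set_conv_nth nth_eq_iff_index_eq)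
    moreover have "indep (insert (B ! k) (set (take (Suc j) B)))"
      using assms(3) set_take_subset[of "Suc j" B] by (intro indep_subset[OF assms(1)]) auto
    ultimately show False using j assms(3) \<open>\<not> k \<le> j\<close> by auto
  qed
qed

end

text \<open>Remove the element \<open>x\<close> of highest level. All others have strictly smaller
  level and lie in the closure of the initial segment of \<open>B\<close> of length
  \<open>flag_level B x\<close>, while \<open>x\<close> lies outside that closure.\<close>

lemma (in simple_matroid) indep_if_inj_flag_level:
  assumes B: "indep (set B)" and "finite X" "X \<subseteq> E" "inj_on (flag_level B) X"
  shows "indep X"
  using assms(2-)
proof (induction "card X" arbitrary: X)
  case 0
  then show ?case using indep_empty by simp
next
  case (Suc n)
  then have "X \<noteq> {}" by auto
  then obtain x where x: "x \<in> X" "flag_level B x = Max (flag_level B ` X)"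
    using Max_in[of "flag_level B ` X"] Suc.prems(1) by fastforce
  let ?k = "flag_level B x" and ?Y = "set (take (flag_level B x) B)"
  have X': "indep (X - {x})"
    using Suc.hyps(2) Suc.prems x by (intro Suc.hyps(1)) (auto intro: inj_on_subset)
  have "x \<notin> ?Y \<and> indep (insert x ?Y)"
  proof (cases ?k)
    case 0
    then show ?thesis using no_loops x Suc.prems by auto
  next
    case (Suc j)
    then show ?thesis using below_flag_level[of j B x] by simp
  qed
  moreover have "y \<in> ?Y \<or> \<not> indep (insert y ?Y)" if "y \<in> X - {x}" for y
  proof -
    have "flag_level B y \<noteq> ?k" using that x(1) inj_onD[OF Suc.prems(3), of y x] by auto
    moreover have "flag_level B y \<le> ?k" using that x Suc.prems(1) by simp
    ultimately have less: "flag_level B y < ?k" by simp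
    then have sub: "set (take (Suc (flag_level B y)) B) \<subseteq> ?Y"
      by (intro set_take_subset_set_take) simp
    have "flag_level B y \<noteq> length B" using less flag_level_le[of B x] by simp
    then show ?thesis
      using flag_level_prop[of B y] sub indep_subset[of "insert y ?Y"] by blast
  qed
  ultimately have "indep (insert x (X - {x}))"
    using X' by (intro indep_insert_outside_closure[of "X - {x}" x ?Y]) auto
  then show ?case using x by (simp add: insert_absorb)
qed

text \<open>The sign of the permutation that sorts the word, and 0 if a letter repeats: an
  alternating form that separates increasing words from 0 in the exterior algebra.\<close>

fun word_sign :: "'a::linorder list \<Rightarrow> complex" where
  "word_sign [] = 1"
| "word_sign (i # u) = (\<Prod>j\<leftarrow>u. if i < j then 1 else if i = j then 0 else - 1) * word_sign u"

lemma word_sign_swap: "word_sign (u @ i # j # v) = - word_sign (u @ j # i # v)"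
  by (induction u) auto

lemma word_sign_sorted: "sorted_wrt (<) u \<Longrightarrow> word_sign u = 1"
proof (induction u)
  case (Cons i u)
  then have "map (\<lambda>j. if i < j then 1 else if i = j then 0 else - 1) u = map (\<lambda>j. 1 :: complex) u"
    by (intro map_cong) auto
  then have "(\<Prod>j\<leftarrow>u. if i < j then 1 else if i = j then 0 else - 1 :: complex) = (\<Prod>j\<leftarrow>u. 1)"
    by (rule arg_cong)
  also have "\<dots> = 1" by (induction u) auto
  finally show ?case using Cons by simp
qed simp

lemma word_sign_os_ker:
  assumes "p \<in> os_ker UNIV (\<lambda>_. True)"
  shows "lin_ext (\<lambda>u. cst (word_sign u) :: 'b word \<Rightarrow>\<^sub>0 complex) p = 0" (is "?L p = 0")
  using assms
proof induction
  case (square v x y)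
  \<comment> \<open>The polarized statement is bilinear in \<open>v\<close> and \<open>w\<close>, so
    it reduces to two adjacent letters, where \<open>word_sign_swap\<close> applies.\<close>
  have swap: "?L (wd u * (v * w) * wd u') + ?L (wd u * (w * v) * wd u') = 0" (is "?S v w = 0")
    if v: "v \<in> tens_deg UNIV 1" and w: "w \<in> tens_deg UNIV 1" for v w u u'
  proof -
    have add: "?S (v + v') w = ?S v w + ?S v' w" "?S v (w + w') = ?S v w + ?S v w'" for v v' w w'
      by (simp_all only: distrib_left distrib_right lin_ext_add) (simp_all only: ac_simps)
    have letters: "?S (cst c * wd [i]) (cst d * wd [j]) = 0" for c d i j
    proof -
      have "?S (cst c * wd [i]) (cst d * wd [j]) =
          cst (c * d) * ?L (wd (u @ i # j # u')) + cst (c * d) * ?L (wd (u @ j # i # u'))"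
        by (simp add: mult_single plus_word_def zero_word_def lin_ext_single mult.commute)
      also have "\<dots> = 0"
        by (simp only: lin_ext_wd word_sign_swap[of u i j] single_uminus) simp
      finally show ?thesis .
    qed
    have left: "?S (cst c * wd [i]) w = 0" for c i
      using w
    proof (induction w rule: tens_deg_induct)
      case (monom d t)
      then obtain j where "t = [j]" by (auto simp: length_Suc_conv)
      then show ?case by (simp only: letters)
    qed (simp_all only: add, simp_all)
    show ?thesis
      using v
    proof (induction v rule: tens_deg_induct)
      case (monom c s)
      then obtain i where "s = [i]" by (auto simp: length_Suc_conv)
      then show ?case by (simp only: left)
    qed (simp_all only: add, simp_all)
  qed
  have words: "?L (wd u * (v * v) * wd u') = 0" for u u'
  proof -
    let ?z = "?L (wd u * (v * v) * wd u')"
    \<comment> \<open>Setting \<open>w = v\<close> gives only twice the value; coefficientwise it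
      can be halved.\<close>
    have "?z + ?z = 0" using swap square(1) by blast
    then have "Poly_Mapping.lookup (?z + ?z) k = 0" for k by simp
    then show ?thesis by (intro poly_mapping_eqI) (simp add: lookup_add)
  qed
  have "?L (wd u * (v * v) * y) = 0" for u
    by (induction y rule: pm_induct)
       (simp_all add: words distrib_left lin_ext_add cst_left_commute lin_ext_cst_mult)
  then show ?case
    by (induction x rule: pm_induct)
       (simp_all add: mult.assoc distrib_right lin_ext_add lin_ext_cst_mult)
qed (simp_all add: lin_ext_add)

text \<open>
  A dependent set has two elements of the same level, so replacing letters by their levels maps the
  Orlik--Solomon ideal into the ideal of squares, while a word listing \<open>B\<close> becomes a strictly
  increasing word, which \<open>word_sign\<close> detects.
\<close>

lemma (in simple_matroid) indep_word_not_os_ker: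
  assumes B: "indep (set B)" "distinct B"
  shows "wd B \<notin> os_ker E indep"
proof
  assume wd: "wd B \<in> os_ker E indep"
  let ?f = "\<lambda>i. wd [flag_level B i] :: nat word \<Rightarrow>\<^sub>0 complex"
  have words: "alg_ext ?f (wd S) = wd (map (flag_level B) S)" for S
    by (simp add: prod_list_letters)
  have "alg_ext ?f (wd B) \<in> os_ker UNIV (\<lambda>_. True)"
  proof (rule alg_ext_os_ker[OF wd])
    fix S assume S: "set S \<subseteq> E" "\<not> indep (set S)"
    then have "\<not> inj_on (flag_level B) (set S)"
      using indep_if_inj_flag_level[OF B(1) finite_set S(1)] S(2) by iprover
    then have "\<not> distinct (map (flag_level B) S)"
      by (simp add: distinct_map)
    then have "wd (map (flag_level B) S) \<in> os_ker UNIV (\<lambda>_. True)"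
      by (intro repeated_word_os_ker) auto
    then have "der (\<lambda>_. 1) (alg_ext ?f (wd S)) \<in> os_ker UNIV (\<lambda>_. True)"
      unfolding words by (rule der_os_ker)
    also have "der (\<lambda>_. 1) (alg_ext ?f (wd S)) = alg_ext ?f (der (\<lambda>_. 1) (wd S))"
    proof (rule der_alg_ext)
      show "wd S \<in> tens E" by (rule tens_wd[OF S(1)])
      show "?f i \<in> tens_deg UNIV 1" for i by (simp add: tens_deg_wd)
    qed simp
    finally show "alg_ext ?f (bnd S) \<in> os_ker UNIV (\<lambda>_. True)" by simp
  qed (simp add: tens_deg_wd)
  then have "wd (map (flag_level B) B) \<in> os_ker UNIV (\<lambda>_. True)"
    unfolding words .
  moreover have "map (flag_level B) B = [0..<length B]"
    by (rule nth_equalityI) (simp_all add: flag_level_nth[OF B])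
  ultimately have "wd [0..<length B] \<in> os_ker UNIV (\<lambda>_. True)"
    by (rule back_subst[where P = "\<lambda>u. wd u \<in> _"])
  from word_sign_os_ker[OF this] have "cst (word_sign [0..<length B]) = (0 :: nat word \<Rightarrow>\<^sub>0 complex)"
    by (simp only: lin_ext_wd)
  moreover have "word_sign [0..<length B] = 1"
    by (intro word_sign_sorted sorted_wrt_upt)
  ultimately show False by simp
qed

section \<open>The rank as the top degree of the algebra\<close>

lemma (in matroid) finite_indep_sets: "finite {X. indep X}"
  by (rule finite_subset[OF _ finite_Pow_iff[THEN iffD2, OF finite_ground]])
     (use indep_subset_ground in blast)

lemma (in matroid) card_le_rank: "indep X \<Longrightarrow> card X \<le> matroid_rank indep"
  unfolding matroid_rank_def by (rule Max_ge) (simp_all add: finite_indep_sets)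

lemma (in matroid) basis_exists: "\<exists>B. indep B \<and> card B = matroid_rank indep"
proof -
  have "Max (card ` {X. indep X}) \<in> card ` {X. indep X}"
    by (rule Max_in) (use finite_indep_sets indep_empty in blast)+
  then show ?thesis
    unfolding matroid_rank_def by force
qed

text \<open>A word longer than the rank either repeats a letter or lists a dependent set. Together
  with \<open>indep_word_not_os_ker\<close> this makes the rank an invariant of the graded
  algebra.\<close>

lemma (in matroid) tens_deg_above_rank:
  assumes "p \<in> tens_deg E n" "matroid_rank indep < n"
  shows "p \<in> os_ker E indep"
  using assms(1)
proof (induction rule: tens_deg_induct)
  case (monom c u)
  have "wd u \<in> os_ker E indep"
  proof (cases "distinct u")
    case True
    then have "card (set u) = n" using monom distinct_card by blast
    then have "\<not> indep (set u)" using card_le_rank[of "set u"] assms(2) by linarith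
    moreover have "u \<noteq> []" using monom assms(2) by (cases u) simp_all
    ultimately show ?thesis using monom(1) by (intro dependent_word_os_ker)
  next
    case False
    with monom(1) show ?thesis by (rule repeated_word_os_ker)
  qed
  then show ?case by (rule os_ker_cst_mult)
qed (rule os_ker.zero, rule os_ker.add)

section \<open>Isomorphisms as substitutions of letters\<close>

text \<open>An isomorphism lifted to the tensor algebras. The two substitutions are inverse on the
  letters exactly, not merely modulo the ideals, which for simple matroids loses nothing.\<close>

definition os_equiv ::
    "'a set \<Rightarrow> ('a set \<Rightarrow> bool) \<Rightarrow> 'b set \<Rightarrow> ('b set \<Rightarrow> bool) \<Rightarrow>
     ('a \<Rightarrow> 'b word \<Rightarrow>\<^sub>0 complex) \<Rightarrow> ('b \<Rightarrow> 'a word \<Rightarrow>\<^sub>0 complex) \<Rightarrow> bool" where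
  "os_equiv E P E' P' f g \<longleftrightarrow>
    (\<forall>i\<in>E. f i \<in> tens_deg E' 1) \<and> (\<forall>j\<in>E'. g j \<in> tens_deg E 1) \<and>
    (\<forall>i\<in>E. alg_ext g (f i) = wd [i]) \<and> (\<forall>j\<in>E'. alg_ext f (g j) = wd [j]) \<and>
    (\<forall>p\<in>os_ker E P. alg_ext f p \<in> os_ker E' P') \<and> (\<forall>q\<in>os_ker E' P'. alg_ext g q \<in> os_ker E P)"

lemma os_equiv_sym: "os_equiv E P E' P' f g \<Longrightarrow> os_equiv E' P' E P g f"
  by (simp add: os_equiv_def)

lemma os_equivD:
  assumes "os_equiv E P E' P' f g"
  shows "i \<in> E \<Longrightarrow> f i \<in> tens_deg E' 1"
    and "p \<in> tens E \<Longrightarrow> alg_ext f p \<in> tens E'"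
    and "p \<in> tens_deg E n \<Longrightarrow> alg_ext f p \<in> tens_deg E' n"
    and "p \<in> os_ker E P \<Longrightarrow> alg_ext f p \<in> os_ker E' P'"
    and "p \<in> tens E \<Longrightarrow> alg_ext g (alg_ext f p) = p"
proof -
  have f: "f i \<in> tens_deg E' 1" if "i \<in> E" for i
    using assms that by (simp add: os_equiv_def)
  show "i \<in> E \<Longrightarrow> f i \<in> tens_deg E' 1" by (rule f)
  show "p \<in> tens E \<Longrightarrow> alg_ext f p \<in> tens E'" by (rule alg_ext_tens[OF _ f])
  show "p \<in> tens_deg E n \<Longrightarrow> alg_ext f p \<in> tens_deg E' n" by (rule alg_ext_tens_deg[OF _ f])
  show "p \<in> os_ker E P \<Longrightarrow> alg_ext f p \<in> os_ker E' P'"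
    using assms by (simp add: os_equiv_def)
  show "alg_ext g (alg_ext f p) = p" if "p \<in> tens E"
    using alg_ext_compose[OF that, of g f "\<lambda>i. wd [i]"] assms by (simp add: alg_ext_ident os_equiv_def)
qed

lemma os_equiv_trans:
  assumes 1: "os_equiv E P E' P' f g" and 2: "os_equiv E' P' E'' P'' f' g'"
  shows "os_equiv E P E'' P'' (\<lambda>i. alg_ext f' (f i)) (\<lambda>k. alg_ext g (g' k))"
proof -
  note sym = os_equiv_sym[OF 1] os_equiv_sym[OF 2]
  have f: "alg_ext (\<lambda>i. alg_ext f' (f i)) p = alg_ext f' (alg_ext f p)" if "p \<in> tens E" for p
    using alg_ext_compose[OF that] by metis
  have g: "alg_ext (\<lambda>k. alg_ext g (g' k)) p = alg_ext g (alg_ext g' p)" if "p \<in> tens E''" for p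
    using alg_ext_compose[OF that] by metis
  have fi: "alg_ext f' (f i) \<in> tens_deg E'' 1" if "i \<in> E" for i
    by (rule os_equivD(3)[OF 2 os_equivD(1)[OF 1 that]])
  have gk: "alg_ext g (g' k) \<in> tens_deg E 1" if "k \<in> E''" for k
    by (rule os_equivD(3)[OF sym(1) os_equivD(1)[OF sym(2) that]])
  have "alg_ext (\<lambda>k. alg_ext g (g' k)) (alg_ext f' (f i)) = wd [i]" if i: "i \<in> E" for i
  proof -
    have "f i \<in> tens E'" by (rule tens_deg_subset[OF os_equivD(1)[OF 1 i]])
    then have "alg_ext (\<lambda>k. alg_ext g (g' k)) (alg_ext f' (f i)) = alg_ext g (f i)"
      by (simp only: g[OF os_equivD(2)[OF 2]] os_equivD(5)[OF 2])
    then show ?thesis using 1 i by (simp add: os_equiv_def)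
  qed
  moreover have "alg_ext (\<lambda>i. alg_ext f' (f i)) (alg_ext g (g' k)) = wd [k]" if k: "k \<in> E''" for k
  proof -
    have "g' k \<in> tens E'" by (rule tens_deg_subset[OF os_equivD(1)[OF sym(2) k]])
    then have "alg_ext (\<lambda>i. alg_ext f' (f i)) (alg_ext g (g' k)) = alg_ext f' (g' k)"
      by (simp only: f[OF os_equivD(2)[OF sym(1)]] os_equivD(5)[OF sym(1)])
    then show ?thesis using 2 k by (simp add: os_equiv_def)
  qed
  moreover have "alg_ext (\<lambda>i. alg_ext f' (f i)) p \<in> os_ker E'' P''" if "p \<in> os_ker E P" for p
    unfolding f[OF os_ker_tens[OF that]] by (rule os_equivD(4)[OF 2 os_equivD(4)[OF 1 that]])
  moreover have "alg_ext (\<lambda>k. alg_ext g (g' k)) q \<in> os_ker E P" if "q \<in> os_ker E'' P''" for q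
    unfolding g[OF os_ker_tens[OF that]] by (rule os_equivD(4)[OF sym(1) os_equivD(4)[OF sym(2) that]])
  ultimately show ?thesis
    using fi gk unfolding os_equiv_def by blast
qed

lemma graded_algebra_isomorphic_if_os_equiv:
  assumes "os_equiv E P E' P' f g"
  shows "graded_algebra_isomorphic (os_algebra E P) (os_algebra E' P')"
proof -
  note eq = assms os_equiv_sym[OF assms]
  let ?A = "os_algebra E P" and ?B = "os_algebra E' P'"
  define h where "h X = os_proj E' P' (alg_ext f (SOME p. p \<in> tens E \<and> os_proj E P p = X))" for X
  have h: "h (os_proj E P p) = os_proj E' P' (alg_ext f p)" if p: "p \<in> tens E" for p
  proof -
    define q where "q = (SOME q. q \<in> tens E \<and> os_proj E P q = os_proj E P p)"
    have q: "q \<in> tens E \<and> os_proj E P q = os_proj E P p"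
      unfolding q_def by (rule someI[of _ p]) (simp add: p)
    \<comment> \<open>The chosen representative is immaterial, because the substitution preserves
      the ideals.\<close>
    then have "alg_ext f (q - p) \<in> os_ker E' P'"
      using p by (intro os_equivD(4)[OF eq(1)]) (simp flip: os_proj_eq_iff)
    then have "os_proj E' P' (alg_ext f q) = os_proj E' P' (alg_ext f p)"
      using p q by (simp add: os_proj_simps os_equivD(2)[OF eq(1)] alg_ext_simps)
    then show ?thesis by (simp add: h_def q_def)
  qed
  have inj: "inj_on h (carrier ?A)"
  proof (rule inj_onI)
    fix X Y assume "X \<in> carrier ?A" "Y \<in> carrier ?A" and eqh: "h X = h Y"
    then obtain p q where pq: "p \<in> tens E" "q \<in> tens E" "X = os_proj E P p" "Y = os_proj E P q"
      by (auto simp: os_algebra_fields)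
    then have "alg_ext f p - alg_ext f q \<in> os_ker E' P'"
      using eqh by (simp add: h os_proj_simps os_equivD(2)[OF eq(1)])
    from os_equivD(4)[OF eq(2) this] show "X = Y"
      using pq by (simp add: os_proj_simps alg_ext_simps os_equivD(5)[OF eq(1)])
  qed
  have image: "alg_ext f ` tens E = tens E'" "alg_ext f ` tens_deg E n = tens_deg E' n" for n
  proof -
    show "alg_ext f ` tens E = tens E'"
    proof (intro equalityI subsetI)
      fix q assume q: "q \<in> tens E'"
      show "q \<in> alg_ext f ` tens E"
        using os_equivD(5)[OF eq(2) q, symmetric] os_equivD(2)[OF eq(2) q] by (rule image_eqI)
    qed (use os_equivD(2)[OF eq(1)] in blast)
    show "alg_ext f ` tens_deg E n = tens_deg E' n"
    proof (intro equalityI subsetI)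
      fix q assume q: "q \<in> tens_deg E' n"
      show "q \<in> alg_ext f ` tens_deg E n"
        using os_equivD(5)[OF eq(2) tens_deg_subset[OF q], symmetric] os_equivD(3)[OF eq(2) q]
        by (rule image_eqI)
    qed (use os_equivD(3)[OF eq(1)] in blast)
  qed
  have h_image: "h ` os_proj E P ` T = os_proj E' P' ` alg_ext f ` T" if "T \<subseteq> tens E" for T
    unfolding image_image using that by (intro image_cong) (auto simp: h)
  have sub: "tens_deg E n \<subseteq> tens E" for n using tens_deg_subset by blast
  have "h \<in> ring_hom ?A ?B"
  proof (rule ring_hom_memI)
    show "h X \<in> carrier ?B" if "X \<in> carrier ?A" for X
      using that by (auto simp: os_algebra_fields h os_equivD(2)[OF eq(1)])
    show "h (X \<otimes>\<^bsub>?A\<^esub> Y) = h X \<otimes>\<^bsub>?B\<^esub> h Y" if "X \<in> carrier ?A" "Y \<in> carrier ?A" for X Y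
      using that by (auto simp: os_algebra_fields os_proj_simps h os_equivD(2)[OF eq(1)] tens_mult alg_ext_mult)
    show "h (X \<oplus>\<^bsub>?A\<^esub> Y) = h X \<oplus>\<^bsub>?B\<^esub> h Y" if "X \<in> carrier ?A" "Y \<in> carrier ?A" for X Y
      using that by (auto simp: os_algebra_fields os_proj_simps h os_equivD(2)[OF eq(1)] tens_add alg_ext_simps)
    show "h \<one>\<^bsub>?A\<^esub> = \<one>\<^bsub>?B\<^esub>"
      by (simp add: os_algebra_fields h alg_ext_simps)
  qed
  moreover have "bij_betw h (carrier ?A) (carrier ?B)"
    using inj h_image[of "tens E"] by (simp add: bij_betw_def os_algebra_fields image)
  moreover have "h (c \<odot>\<^bsub>?A\<^esub> X) = c \<odot>\<^bsub>?B\<^esub> h X" if "X \<in> carrier ?A" for c X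
    using that by (auto simp: os_algebra_fields os_proj_simps h os_equivD(2)[OF eq(1)] tens_mult alg_ext_simps)
  moreover have "h ` homog ?A n = homog ?B n" for n
    unfolding os_algebra_fields h_image[OF sub] image ..
  ultimately have "h \<in> graded_algebra_iso ?A ?B"
    by (simp add: graded_algebra_iso_def ring_iso_def)
  then show ?thesis by (auto simp: graded_algebra_isomorphic_def)
qed

text \<open>The algebra is generated in degree one, so \<open>h\<close> is determined by degree-one
  lifts of the images of letters. By \<open>small\<close> such lifts are unique, hence the lifts of
  \<open>h\<close> and of its inverse are inverse to each other.\<close>

lemma os_equiv_if_graded_algebra_isomorphic:
  assumes "graded_algebra_isomorphic (os_algebra E P) (os_algebra E' P')"
    and small: "\<And>X. X \<subseteq> E \<Longrightarrow> card X \<le> 2 \<Longrightarrow> P X" "\<And>X. X \<subseteq> E' \<Longrightarrow> card X \<le> 2 \<Longrightarrow> P' X"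
  shows "\<exists>f g. os_equiv E P E' P' f g"
proof -
  let ?A = "os_algebra E P" and ?B = "os_algebra E' P'"
  obtain h where "h \<in> graded_algebra_iso ?A ?B"
    using assms(1) by (auto simp: graded_algebra_isomorphic_def)
  then have hom: "h \<in> ring_hom ?A ?B" and inj: "inj_on h (carrier ?A)"
    and smult: "\<And>c X. X \<in> carrier ?A \<Longrightarrow> h (c \<odot>\<^bsub>?A\<^esub> X) = c \<odot>\<^bsub>?B\<^esub> h X"
    and homog: "\<And>n. h ` homog ?A n = homog ?B n"
    by (auto simp: graded_algebra_iso_def ring_iso_def bij_betw_def)
  have "\<exists>q. q \<in> tens_deg E' 1 \<and> h (os_proj E P (wd [i])) = os_proj E' P' q" if "i \<in> E" for i
  proof -
    have "os_proj E P (wd [i]) \<in> homog ?A 1"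
      using that by (auto simp: os_algebra_fields intro!: imageI tens_deg_wd)
    then have "h (os_proj E P (wd [i])) \<in> homog ?B 1" using homog by blast
    then show ?thesis by (auto simp: os_algebra_fields)
  qed
  then obtain f where f: "\<And>i. i \<in> E \<Longrightarrow> f i \<in> tens_deg E' 1"
    "\<And>i. i \<in> E \<Longrightarrow> h (os_proj E P (wd [i])) = os_proj E' P' (f i)" by metis
  have "\<exists>p. p \<in> tens_deg E 1 \<and> h (os_proj E P p) = os_proj E' P' (wd [j])" if "j \<in> E'" for j
  proof -
    have "os_proj E' P' (wd [j]) \<in> homog ?B 1"
      using that by (auto simp: os_algebra_fields intro!: imageI tens_deg_wd)
    then have "os_proj E' P' (wd [j]) \<in> h ` homog ?A 1" using homog by blast
    then show ?thesis by (auto simp: os_algebra_fields)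
  qed
  then obtain g where g: "\<And>j. j \<in> E' \<Longrightarrow> g j \<in> tens_deg E 1"
    "\<And>j. j \<in> E' \<Longrightarrow> h (os_proj E P (g j)) = os_proj E' P' (wd [j])" by metis
  have F: "alg_ext f p \<in> tens E'" if "p \<in> tens E" for p by (rule alg_ext_tens[OF that f(1)])
  have G: "alg_ext g p \<in> tens E" if "p \<in> tens E'" for p by (rule alg_ext_tens[OF that g(1)])
  have hF: "h (os_proj E P p) = os_proj E' P' (alg_ext f p)" if "p \<in> tens E" for p
  proof -
    have "p \<in> tens E \<and> h (os_proj E P p) = os_proj E' P' (alg_ext f p)"
      using that
    proof (induction rule: tens_induct)
      case zero
      \<comment> \<open>\<open>ring_hom\<close> requires sums, products and one to be preserved; the
        value at zero comes from the scalar 0 acting on one.\<close>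
      have "h (os_proj E P 0) = 0 \<odot>\<^bsub>?B\<^esub> \<one>\<^bsub>?B\<^esub>"
        using smult[of "os_proj E P 1" 0] ring_hom_one[OF hom]
        by (simp add: os_algebra_fields os_proj_simps)
      then show ?case by (simp add: os_algebra_fields os_proj_simps alg_ext_simps)
    next
      case (monom c u)
      have "h (os_proj E P (wd u)) = os_proj E' P' (alg_ext f (wd u))"
        using monom
      proof (induction u)
        case Nil
        then show ?case using ring_hom_one[OF hom] by (simp add: os_algebra_fields alg_ext_simps)
      next
        case (Cons i u)
        then have t: "wd [i] \<in> tens E" "wd u \<in> tens E" by (auto intro: tens_wd)
        have "h (os_proj E P (wd (i # u))) = h (os_proj E P (wd [i])) \<otimes>\<^bsub>?B\<^esub> h (os_proj E P (wd u))"
          unfolding wd_Cons[of i u] os_proj_mult[OF t, symmetric]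
          using t by (intro ring_hom_mult[OF hom]) (simp_all add: os_algebra_fields)
        also have "\<dots> = os_proj E' P' (alg_ext f (wd (i # u)))"
          using Cons tens_deg_subset[OF f(1)] F[OF t(2)]
          by (simp add: f(2) os_proj_simps)
        finally show ?case .
      qed
      moreover have t: "wd u \<in> tens E" using monom by (rule tens_wd)
      moreover have "h (os_proj E P (cst c * wd u)) = c \<odot>\<^bsub>?B\<^esub> h (os_proj E P (wd u))"
        unfolding os_proj_smult[OF t, symmetric]
        using t by (intro smult) (simp add: os_algebra_fields)
      ultimately show ?case
        using F[OF t] by (simp only: os_proj_smult alg_ext_simps tens_mult[OF tens_cst t] simp_thms)
    next
      case (add p q)
      then have "h (os_proj E P (p + q)) = h (os_proj E P p) \<oplus>\<^bsub>?B\<^esub> h (os_proj E P q)"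
        by (simp add: os_proj_add[symmetric] ring_hom_add[OF hom] os_algebra_fields)
      with add F show ?case by (simp add: os_proj_add alg_ext_simps tens_add)
    qed
    then show ?thesis by simp
  qed
  \<comment> \<open>Injectivity of \<open>h\<close> gives the converse inclusion of kernels, which
    also shows that \<open>g\<close> preserves the ideals.\<close>
  have ker: "p \<in> os_ker E P \<longleftrightarrow> alg_ext f p \<in> os_ker E' P'" if p: "p \<in> tens E" for p
  proof -
    have "p \<in> os_ker E P \<longleftrightarrow> os_proj E P p = os_proj E P 0"
      using p by (simp add: os_proj_simps)
    also have "\<dots> \<longleftrightarrow> h (os_proj E P p) = h (os_proj E P 0)"
      using inj p by (auto simp: os_algebra_fields dest: inj_onD)
    also have "\<dots> \<longleftrightarrow> alg_ext f p \<in> os_ker E' P'"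
      using p F[OF p] by (simp add: hF os_proj_simps alg_ext_simps)
    finally show ?thesis .
  qed
  have gt: "g j \<in> tens E" if "j \<in> E'" for j by (rule tens_deg_subset[OF g(1)[OF that]])
  have ft: "f i \<in> tens E'" if "i \<in> E" for i by (rule tens_deg_subset[OF f(1)[OF that]])
  have fg: "alg_ext f (g j) = wd [j]" if j: "j \<in> E'" for j
  proof -
    have "os_proj E' P' (alg_ext f (g j)) = os_proj E' P' (wd [j])"
      using g(2)[OF j] hF[OF gt[OF j]] by simp
    then have "alg_ext f (g j) - wd [j] \<in> os_ker E' P'"
      using j F[OF gt[OF j]] by (simp add: os_proj_simps tens_wd)
    moreover have "alg_ext f (g j) - wd [j] \<in> tens_deg E' 1"
      using j by (intro tens_deg_diff alg_ext_tens_deg[OF g(1) f(1)] tens_deg_wd) auto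
    ultimately have "alg_ext f (g j) - wd [j] = 0" by (rule os_ker_degree_one[OF _ _ small(2)])
    then show ?thesis by simp
  qed
  have FG: "alg_ext f (alg_ext g q) = q" if "q \<in> tens E'" for q
    using alg_ext_compose[OF that fg] by (simp add: alg_ext_ident)
  have gf: "alg_ext g (f i) = wd [i]" if i: "i \<in> E" for i
  proof -
    have t: "wd [i] \<in> tens E" using i by (intro tens_wd) auto
    have "alg_ext f (alg_ext g (f i) - wd [i]) = 0"
      by (simp add: alg_ext_simps FG[OF ft[OF i]])
    then have "alg_ext g (f i) - wd [i] \<in> os_ker E P"
      using t G[OF ft[OF i]] by (subst ker) (auto intro: tens_diff os_ker.zero)
    moreover have "alg_ext g (f i) - wd [i] \<in> tens_deg E 1"
      using i by (intro tens_deg_diff alg_ext_tens_deg[OF f(1) g(1)] tens_deg_wd) auto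
    ultimately have "alg_ext g (f i) - wd [i] = 0" by (rule os_ker_degree_one[OF _ _ small(1)])
    then show ?thesis by simp
  qed
  have "alg_ext g q \<in> os_ker E P" if q: "q \<in> os_ker E' P'" for q
    using ker[OF G[OF os_ker_tens[OF q]]] q by (simp add: FG os_ker_tens)
  moreover have "alg_ext f p \<in> os_ker E' P'" if "p \<in> os_ker E P" for p
    using ker[OF os_ker_tens[OF that]] that by simp
  ultimately have "os_equiv E P E' P' f g"
    using f(1) g(1) fg gf by (simp add: os_equiv_def)
  then show ?thesis by blast
qed

section \<open>Making an isomorphism commute with the boundary\<close>

lemma der_zero_weight:
  assumes "p \<in> tens E" "\<And>i. i \<in> E \<Longrightarrow> l i = 0"
  shows "der l p = 0"
  using assms(1)
proof (induction rule: tens_induct)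
  case (monom c u)
  have "word_der l u = 0" using monom by (induction u) (auto simp: assms(2))
  then show ?case by (simp add: der_simps)
qed (simp_all add: der_simps)

lemma der_scale_weight: "der (\<lambda>i. c * l i) p = cst c * der l p"
proof (induction p rule: pm_induct)
  case (monom d u)
  have "word_der (\<lambda>i. c * l i) u = cst c * word_der l u"
  proof (induction u)
    case (Cons i u)
    then show ?case
      by (simp only: word_der.simps cst_mult right_diff_distrib mult.assoc cst_left_commute[of "wd [i]" c])
  qed simp
  then show ?case
    by (simp only: der_simps der_wd cst_left_commute[of "cst d" c])
qed (simp_all add: der_simps distrib_left)

lemma transvection_os_ker:
  assumes "p \<in> os_ker E P" "w \<in> tens_deg E 1" "der m p \<in> os_ker E P"
  shows "alg_ext (\<lambda>i. wd [i] + cst (m i) * w) p \<in> os_ker E P"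
proof -
  have "alg_ext (\<lambda>i. wd [i] + cst (m i) * w) p - (p + w * der m p) \<in> os_ker E P"
    by (rule alg_ext_transvection[OF os_ker_tens[OF assms(1)] assms(2)])
  moreover have "p + w * der m p \<in> os_ker E P"
    by (rule os_ker.add[OF assms(1) os_ker_mult_left[OF assms(3) tens_deg_subset[OF assms(2)]]])
  ultimately have "(alg_ext (\<lambda>i. wd [i] + cst (m i) * w) p - (p + w * der m p)) + (p + w * der m p) \<in> os_ker E P"
    by (rule os_ker.add)
  then show ?thesis by simp
qed

text \<open>A rank-one perturbation of the identity is invertible when \<open>1 + m j\<close> is
  nonzero. Its inverse is a transvection along the same letter with weights proportional to
  \<open>m\<close>, so it preserves the ideal for the same reason.\<close>

lemma os_equiv_transvection:
  assumes j: "j \<in> E" and m: "\<And>p. p \<in> os_ker E P \<Longrightarrow> der m p \<in> os_ker E P" and nz: "1 + m j \<noteq> 0"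
  shows "os_equiv E P E P (\<lambda>i. wd [i] + cst (m i) * wd [j]) (\<lambda>i. wd [i] + cst (- m i / (1 + m j)) * wd [j])"
    (is "os_equiv E P E P ?f ?g")
proof -
  have w: "wd [j] \<in> tens_deg E 1" using j by (simp add: tens_deg_wd)
  have deg: "wd [i] + cst c * wd [j] \<in> tens_deg E 1" if "i \<in> E" for i c
    using that by (intro tens_deg_add tens_deg_cst_mult w tens_deg_wd) auto
  have inverse: "(wd [i] + cst c * wd [j]) + cst d * (wd [j] + cst e * wd [j]) = wd [i]"
    if "c + d * (1 + e) = 0" for i c d e
  proof -
    have "(wd [i] + cst c * wd [j]) + cst d * (wd [j] + cst e * wd [j]) = wd [i] + cst (c + d * (1 + e)) * wd [j]"
      by (simp add: algebra_simps single_add cst_mult flip: mult.assoc)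
    then show ?thesis by (simp only: that single_zero) simp
  qed
  have "der (\<lambda>i. - m i / (1 + m j)) p \<in> os_ker E P" if "p \<in> os_ker E P" for p
    using os_ker_cst_mult[OF m[OF that], of "- 1 / (1 + m j)"] der_scale_weight[of "- 1 / (1 + m j)" m p]
    by simp
  then have "alg_ext ?g p \<in> os_ker E P" if "p \<in> os_ker E P" for p
    using that w by (intro transvection_os_ker)
  moreover have "alg_ext ?f p \<in> os_ker E P" if "p \<in> os_ker E P" for p
    by (rule transvection_os_ker[OF that w m[OF that]])
  moreover have "alg_ext ?g (?f i) = wd [i]" for i
    using inverse[of "- m i / (1 + m j)" "m i" "- m j / (1 + m j)" i] nz
    by (simp add: alg_ext_simps field_simps)
  moreover have "alg_ext ?f (?g i) = wd [i]" for i
    using inverse[of "m i" "- m i / (1 + m j)" "m j" i] nz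
    by (simp add: alg_ext_simps)
  ultimately show ?thesis
    using deg unfolding os_equiv_def by blast
qed

text \<open>Once all images of letters have boundary 1, \<open>der_alg_ext\<close> shows that both
  substitutions commute with the boundary.\<close>

lemma os_equiv_normalize:
  assumes eq: "os_equiv E P E' P' f g"
  shows "\<exists>f g. os_equiv E P E' P' f g \<and>
    (\<forall>i\<in>E. der (\<lambda>_. 1) (f i) = 1) \<and> (\<forall>j\<in>E'. der (\<lambda>_. 1) (g j) = 1)"
\<comment> \<open>The correction needs a letter of \<open>E'\<close>. If \<open>E\<close> is empty,
  so is \<open>E'\<close>, and the boundary conditions are vacuous.\<close>
proof (cases "E = {}")
  case True
  have "E' = {}"
  proof (rule ccontr)
    assume "E' \<noteq> {}"
    then obtain j where j: "j \<in> E'" by auto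
    then have "g j \<in> tens_deg E 1" by (rule os_equivD(1)[OF os_equiv_sym[OF eq]])
    then have "w \<notin> Poly_Mapping.keys (g j)" for w
      using True by (auto simp: tens_deg_iff)
    then have "g j = 0" by (simp add: poly_mapping_eqI in_keys_iff)
    moreover have "alg_ext f (g j) = wd [j]" using eq j by (simp add: os_equiv_def)
    ultimately have "wd [j] = 0" by (simp add: alg_ext_simps)
    then have "Poly_Mapping.lookup (wd [j]) (Word [j]) = 0" by simp
    then show False by simp
  qed
  with True eq show ?thesis by auto
next
  case False
  note sym = os_equiv_sym[OF eq]
  have "\<exists>c. der (\<lambda>_. 1) (g j) = cst c" if "j \<in> E'" for j
    by (rule der_degree_one[OF os_equivD(1)[OF sym that]])
  \<comment> \<open>On \<open>tens E'\<close>, \<open>der l\<close> is the boundary of the source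
    transported to the target.\<close>
  then obtain l where l: "\<And>j. j \<in> E' \<Longrightarrow> der (\<lambda>_. 1) (g j) = cst (l j)" by metis
  have der_g: "der (\<lambda>_. 1) (alg_ext g q) = alg_ext g (der l q)" if "q \<in> tens E'" for q
    by (rule der_alg_ext[OF that os_equivD(1)[OF sym] l])
  have der_f: "der l (f i) = 1" if i: "i \<in> E" for i
  proof -
    have fi: "f i \<in> tens_deg E' 1" by (rule os_equivD(1)[OF eq i])
    then obtain c where c: "der l (f i) = cst c" using der_degree_one by blast
    have "alg_ext g (der l (f i)) = der (\<lambda>_. 1) (wd [i])"
      using der_g[OF tens_deg_subset[OF fi]] eq i by (simp add: os_equiv_def)
    then show ?thesis using c by simp
  qed
  have der_l: "der l q \<in> os_ker E' P'" if q: "q \<in> os_ker E' P'" for q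
  proof -
    have gq: "alg_ext g q \<in> os_ker E P" by (rule os_equivD(4)[OF sym q])
    have "der l q = der l (alg_ext f (alg_ext g q))"
      using os_equivD(5)[OF sym os_ker_tens[OF q]] by simp
    also have "\<dots> = alg_ext f (der (\<lambda>_. 1) (alg_ext g q))"
      by (rule der_alg_ext[OF os_ker_tens[OF gq] os_equivD(1)[OF eq]]) (simp_all add: der_f)
    also have "\<dots> \<in> os_ker E' P'"
      by (rule os_equivD(4)[OF eq der_os_ker[OF gq]])
    finally show ?thesis .
  qed
  \<comment> \<open>The weights cannot all vanish on \<open>E'\<close>, since
    \<open>der l (f i) = 1\<close> for any \<open>i\<close> in \<open>E\<close>.\<close>
  obtain j where j: "j \<in> E'" "l j \<noteq> 0"
  proof -
    obtain i where i: "i \<in> E" using False by auto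
    have "der l (f i) \<noteq> 0" using der_f[OF i] by simp
    then show ?thesis
      using der_zero_weight[OF tens_deg_subset[OF os_equivD(1)[OF eq i]], of l] that by blast
  qed
  \<comment> \<open>Then \<open>der ?m\<close> is the difference of two antiderivations preserving
    the ideal, and \<open>1 + ?m j = l j\<close> is nonzero. As \<open>?t i\<close> has boundary
    \<open>l i\<close>, the substitution intertwines \<open>der l\<close> with the boundary.\<close>
  let ?m = "\<lambda>i. l i - 1"
  let ?t = "\<lambda>i. wd [i] + cst (?m i) * wd [j]"
  let ?t' = "\<lambda>i. wd [i] + cst (- ?m i / (1 + ?m j)) * wd [j]"
  have t: "os_equiv E' P' E' P' ?t ?t'"
  proof (rule os_equiv_transvection[OF j(1)])
    show "der ?m q \<in> os_ker E' P'" if "q \<in> os_ker E' P'" for q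
      unfolding der_diff_weight by (rule os_ker_diff[OF der_l[OF that] der_os_ker[OF that]])
    show "1 + ?m j \<noteq> 0" using j(2) by simp
  qed
  have "der (\<lambda>_. 1) (alg_ext ?t (f i)) = 1" if i: "i \<in> E" for i
  proof -
    have "der (\<lambda>_. 1) (alg_ext ?t (f i)) = alg_ext ?t (der l (f i))"
      by (rule der_alg_ext[OF tens_deg_subset[OF os_equivD(1)[OF eq i]] os_equivD(1)[OF t]])
         (simp_all add: der_simps, simp add: single_diff)
    then show ?thesis by (simp add: der_f[OF i] alg_ext_simps)
  qed
  moreover have "der (\<lambda>_. 1) (alg_ext g (?t' k)) = 1" if k: "k \<in> E'" for k
  proof -
    have t': "?t' k \<in> tens_deg E' 1" by (rule os_equivD(1)[OF os_equiv_sym[OF t] k])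
    have "der l (?t' k) = cst (l k) + cst (- ?m k / (1 + ?m j)) * cst (l j)"
      by (simp only: der_simps der_wd) (simp add: der_simps)
    also have "\<dots> = cst (l k + - ?m k / (1 + ?m j) * l j)"
      by (simp only: single_add cst_mult)
    also have "l k + - ?m k / (1 + ?m j) * l j = 1"
      using j(2) by simp
    finally show ?thesis
      by (simp only: der_g[OF tens_deg_subset[OF t']] alg_ext_simps(2) single_one)
  qed
  ultimately show ?thesis
    using os_equiv_trans[OF eq t] by blast
qed

section \<open>Truncation\<close>

lemma (in simple_matroid) small_indep:
  assumes "X \<subseteq> E" "card X \<le> 2"
  shows "indep X"
proof -
  have "finite X" using assms(1) finite_ground finite_subset by blast
  consider "card X = 0" | "card X = 1" | "card X = 2" using assms(2) by linarith
  then show ?thesis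
  proof cases
    case 1
    then show ?thesis using \<open>finite X\<close> indep_empty by simp
  next
    case 2
    then show ?thesis using assms(1) no_loops by (auto simp: card_1_singleton_iff)
  next
    case 3
    then show ?thesis using assms(1) no_parallel by (auto simp: card_2_iff)
  qed
qed

text \<open>If the target had larger rank, the word of one of its bases would be sent to a degree
  where the source algebra vanishes, and would itself vanish after being sent back.\<close>

lemma rank_le_if_os_equiv:
  assumes M: "simple_matroid E indep" and M': "simple_matroid E' indep'"
    and eq: "os_equiv E indep E' indep' f g"
  shows "matroid_rank indep' \<le> matroid_rank indep"
proof (rule ccontr)
  interpret M: simple_matroid E indep by fact
  interpret M': simple_matroid E' indep' by fact
  note sym = os_equiv_sym[OF eq]
  assume less: "\<not> matroid_rank indep' \<le> matroid_rank indep"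
  obtain X where X: "indep' X" "card X = matroid_rank indep'" using M'.basis_exists by blast
  obtain B where B: "set B = X" "distinct B"
    using finite_distinct_list[OF M'.finite_indep[OF X(1)]] by blast
  have "length B = matroid_rank indep'" using X B distinct_card by metis
  moreover have BE: "set B \<subseteq> E'" using X B M'.indep_subset_ground by simp
  ultimately have "wd B \<in> tens_deg E' (matroid_rank indep')" by (simp add: tens_deg_wd)
  then have "alg_ext g (wd B) \<in> tens_deg E (matroid_rank indep')" by (rule os_equivD(3)[OF sym])
  then have "alg_ext g (wd B) \<in> os_ker E indep"
    using less by (intro M.tens_deg_above_rank) auto
  from os_equivD(4)[OF eq this] have "wd B \<in> os_ker E' indep'"
    by (simp only: os_equivD(5)[OF sym tens_wd[OF BE]])
  moreover have "wd B \<notin> os_ker E' indep'"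
    using X B by (intro M'.indep_word_not_os_ker) auto
  ultimately show False by blast
qed

text \<open>A set of at least \<open>matroid_rank indep\<close> letters is dependent in the
  truncation, and words with a repeated letter lie in the ideal already.\<close>

lemma truncation_boundary:
  assumes "p \<in> tens_deg E n" "matroid_rank indep \<le> n"
  shows "der (\<lambda>_. 1) p \<in> os_ker E (truncation indep)"
  using assms(1)
proof (induction rule: tens_deg_induct)
  case (monom c u)
  have "bnd u \<in> os_ker E (truncation indep)"
  proof (cases "distinct u")
    case True
    then have "card (set u) = n" using monom distinct_card by blast
    then have "\<not> truncation indep (set u)" using assms(2) by (simp add: truncation_def)
    with monom(1) show ?thesis by (intro os_ker_boundary)
  next
    case False
    from der_os_ker[OF repeated_word_os_ker[OF monom(1) False]] show ?thesis by simp
  qed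
  then show ?case by (simp add: der_simps os_ker_cst_mult)
qed (simp_all add: der_simps os_ker.zero os_ker.add)

text \<open>A boundary generator of the truncated ideal either comes from a set dependent in the
  original matroid, where \<open>os_equiv\<close> applies, or is the boundary of a monomial of
  degree at least the rank. In the second case the substitution commutes with the boundary.\<close>

lemma alg_ext_os_ker_truncation:
  assumes "p \<in> os_ker E (truncation indep)" and eq: "os_equiv E indep E' indep' f g"
    and der: "\<And>i. i \<in> E \<Longrightarrow> der (\<lambda>_. 1) (f i) = 1"
    and rank: "matroid_rank indep' \<le> matroid_rank indep"
  shows "alg_ext f p \<in> os_ker E' (truncation indep')"
  using assms(1)
proof (rule alg_ext_os_ker)
  show "f i \<in> tens_deg E' 1" if "i \<in> E" for i by (rule os_equivD(1)[OF eq that])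
  fix S assume S: "set S \<subseteq> E" "\<not> truncation indep (set S)"
  show "alg_ext f (bnd S) \<in> os_ker E' (truncation indep')"
  proof (cases "indep (set S)")
    case True
    then have "matroid_rank indep \<le> length S"
      using S(2) card_length[of S] by (simp add: truncation_def)
    moreover have "alg_ext f (wd S) \<in> tens_deg E' (length S)"
      using S by (intro os_equivD(3)[OF eq] tens_deg_wd) auto
    ultimately have "der (\<lambda>_. 1) (alg_ext f (wd S)) \<in> os_ker E' (truncation indep')"
      using rank by (intro truncation_boundary[of _ E' "length S"]) auto
    also have "der (\<lambda>_. 1) (alg_ext f (wd S)) = alg_ext f (der (\<lambda>_. 1) (wd S))"
      by (rule der_alg_ext[OF tens_wd[OF S(1)] os_equivD(1)[OF eq]]) (simp_all add: der)
    finally show ?thesis by simp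
  next
    case False
    then have "alg_ext f (bnd S) \<in> os_ker E' indep'"
      using S by (intro os_equivD(4)[OF eq] os_ker_boundary)
    then show ?thesis by (rule os_ker_mono) (simp add: truncation_def)
  qed
qed

theorem theorem3p11:
  fixes E :: "'a set" and indep :: "'a set \<Rightarrow> bool"
    and E' :: "'b set" and indep' :: "'b set \<Rightarrow> bool"
  assumes "simple_matroid E indep"
    and "simple_matroid E' indep'"
    and "graded_algebra_isomorphic (os_algebra E indep) (os_algebra E' indep')"
  shows "graded_algebra_isomorphic (os_algebra E (truncation indep))
           (os_algebra E' (truncation indep'))"
proof -
  obtain f0 g0 where "os_equiv E indep E' indep' f0 g0"
    using os_equiv_if_graded_algebra_isomorphic[OF assms(3) simple_matroid.small_indep[OF assms(1)]
        simple_matroid.small_indep[OF assms(2)]] by blast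
  from os_equiv_normalize[OF this] obtain f g where eq: "os_equiv E indep E' indep' f g"
    and f: "\<And>i. i \<in> E \<Longrightarrow> der (\<lambda>_. 1) (f i) = 1" and g: "\<And>j. j \<in> E' \<Longrightarrow> der (\<lambda>_. 1) (g j) = 1"
    by blast
  note sym = os_equiv_sym[OF eq]
  \<comment> \<open>Each of the two inequalities serves one of the two inclusions of truncated
    ideals.\<close>
  have "matroid_rank indep' = matroid_rank indep"
    using rank_le_if_os_equiv[OF assms(1,2) eq] rank_le_if_os_equiv[OF assms(2,1) sym] by simp
  then have rank: "matroid_rank indep' \<le> matroid_rank indep" "matroid_rank indep \<le> matroid_rank indep'"
    by simp_all
  have "alg_ext f p \<in> os_ker E' (truncation indep')" if "p \<in> os_ker E (truncation indep)" for p
    by (rule alg_ext_os_ker_truncation[OF that eq f rank(1)])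
  moreover have "alg_ext g q \<in> os_ker E (truncation indep)" if "q \<in> os_ker E' (truncation indep')" for q
    by (rule alg_ext_os_ker_truncation[OF that sym g rank(2)])
  ultimately have "os_equiv E (truncation indep) E' (truncation indep') f g"
    using eq by (simp add: os_equiv_def)
  then show ?thesis by (rule graded_algebra_isomorphic_if_os_equiv)
qed

end
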